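(* Consider a connected circuit with a single memristor, modeled by the differential-algebraic system \begin{align*} q_m' &= i_m\\ C(v_c)\,v_c' &= i_c\\ L(i_l)\,i_l' &= v_l\\ 0 &= B_m M(q_m) i_m + B_c v_c + B_l v_l + B_r\gamma(i_r) + B_u V + B_j v_j\\ 0 &= Q_m i_m + Q_c i_c + Q_l i_l + Q_r i_r + Q_u i_u + Q_j I , \end{align*} displaying an equilibrium point at a given $(y^*,z^* )$, with $y^*=(q_m^*, v_c^*, i_l^* )$ and $z^*=(i_m^*, i_c^*, v_l^*, i_r^*, v_j^*, i_u^* )$. Assume that $C(v_c^* )$ and $L(i_l^* )$ are non-singular, besides the following. 1. The circuit displays no VC-loops, IL-cutsets, VL-loops or IC-cutsets. 2. The sum of MR-products in proper trees does not vanish. 3. The sum of MR-products in L-proper trees does vanish. Then the algebraic multiplicity of the zero eigenvalue at $(y^*,z^* )$ is greater than one.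
   Context: Circuit: a directed graph whose branches are one memristor (m) and any numbers of capacitors (c), inductors (l), resistors (r), independent voltage sources (u) and independent current sources (j). The subscripts indicate vectors of branch voltages $v$ and currents $i$ of the devices of each type. The memristor has a $C^2$ flux-charge characteristic $\varphi=\phi(q)$, giving $v_m=M(q_m)i_m$ with memristance $M=\phi'$. Capacitors are described by a voltage-dependent capacitance matrix $C(v_c)$, inductors by a current-dependent inductance matrix $L(i_l)$, and resistors by a $C^2$ map $v_r=\gamma(i_r)$ with resistance matrix $R(i_r)=\gamma'(i_r)$; these three matrices need not be diagonal, allowing for coupling effects within each set of devices. No positivity (passivity) of any of these matrices or of $M$ is assumed. $V$ and $I$ are constant vectors (values of the voltage and current sources). Matrices $B=(B_m\ B_c\ B_l\ B_r\ B_u\ B_j)$ and $Q=(Q_m\ Q_c\ Q_l\ Q_r\ Q_u\ Q_j)$ are reduced loop and cutset matrices of the digraph, with columns split by device type. The loop matrix $\tilde B=(b_{ij})$ has $b_{ij}=1$ (resp. $-1$) if edge $j$ is in loop $i$ with the same (resp. opposite) orientation, and $0$ if edge $j$ is not in loop $i$ (each loop being given an orientation); with $m$ edges, $n$ nodes and $k$ connected components (here $k=1$) it has rank $m-n+k$, and $B$ is any $(m-n+k)\times m$ submatrix of full row rank. A cutset is a minimal set of edges whose removal increases the number of connected components, oriented from one of the two resulting components towards the other; the cutset matrix $\tilde Q$ is defined in the same way with cutsets instead of loops, has rank $n-k$, and $Q$ consists of $n-k$ linearly independent rows of $\tilde Q$. The last two equations of the model are Kirchhoff's voltage and current laws. A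 VC-loop (resp. VL-loop) is a loop composed only of voltage sources and/or capacitors (resp. inductors); an IL-cutset (resp. IC-cutset) is a cutset composed only of current sources and/or inductors (resp. capacitors). A proper tree is a spanning tree including all voltage sources and capacitors, and neither current sources nor inductors. An L-proper tree is a spanning tree including all voltage sources and inductors, and neither current sources nor capacitors. The co-tree of a spanning tree is the set of branches not in the tree. The MR-product of a spanning tree is the product of all resistances and memristances in its co-tree branches, evaluated at the equilibrium, and is set to $1$ if all resistors and memristors are located in the tree. Near the equilibrium (where $C$ and $L$ are invertible) the system reads $y'=h(y,z)$, $0=g(y,z)$ with $y=(q_m,v_c,i_l)$, $z=(i_m,i_c,v_l,i_r,v_j,i_u)$, $h=(i_m,\ C(v_c)^{-1}i_c,\ L(i_l)^{-1}v_l)$, and $g$ given by the right-hand sides of the last two equations. An equilibrium is a point where $h=0$ and $g=0$ (so $i_m^*=0$, $i_c^*=0$, $v_l^*=0$). The algebraic multiplicity of the zero eigenvalue at $(y^*,z^* )$ is the multiplicity of $\lambda=0$ as a root of $\det(\lambda E-F'(y^*,z^* ))$, where $F=(h,g)$ and $E=\begin{pmatrix} I&0\\0&0\end{pmatrix}$ (identity block of the size of $y$).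
   Formalization: The resistance matrix R is assumed diagonal at the equilibrium, so that MR-products of individual resistances make sense; with coupled resistors (m, c, r1, r2 in parallel, R=[[1,1/2],[1/2,1]], M=-1/2, C=1) the claim fails. *)

theory Defs
  imports
    "HOL-Analysis.Analysis"
    "HOL-Computational_Algebra.Polynomial"
    "Graph_Theory.Digraph_Component"
begin

section \<open>Loops, cutsets and spanning trees of a digraph\<close>

text \<open>
  Loops ignore the orientation of the arcs, and parallel arcs and self-loops are allowed.  Hence
  neither the directed cycles of the library nor its trees (which only exclude directed cycles) can
  be used.  A loop is traversed by a list of pairs \<open>(e, s)\<close>, where \<open>s\<close> tells whether the arc \<open>e\<close> is
  passed in its own direction.
\<close>

definition step_tail :: "('v, 'e) pre_digraph \<Rightarrow> 'e \<times> bool \<Rightarrow> 'v" where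
  "step_tail G s = (if snd s then tail G (fst s) else head G (fst s))"

definition step_head :: "('v, 'e) pre_digraph \<Rightarrow> 'e \<times> bool \<Rightarrow> 'v" where
  "step_head G s = (if snd s then head G (fst s) else tail G (fst s))"

text \<open>
  The equation with \<^const>\<open>rotate1\<close> says that each step ends where the next one (cyclically) starts.
\<close>

definition oriented_loop :: "('v, 'e) pre_digraph \<Rightarrow> ('e \<times> bool) list \<Rightarrow> bool" where
  "oriented_loop G p \<longleftrightarrow>
     p \<noteq> [] \<and> fst ` set p \<subseteq> arcs G \<and> distinct (map fst p) \<and> distinct (map (step_tail G) p) \<and>
     map (step_head G) p = rotate1 (map (step_tail G) p)"

definition is_loop :: "('v, 'e) pre_digraph \<Rightarrow> 'e set \<Rightarrow> bool" where
  "is_loop G S \<longleftrightarrow> (\<exists>p. oriented_loop G p \<and> S = fst ` set p)"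

definition loop_row :: "('e \<times> bool) list \<Rightarrow> real ^ 'e" where
  "loop_row p = (\<chi> e. if (e, True) \<in> set p then 1 else if (e, False) \<in> set p then - 1 else 0)"

text \<open>The vertex sets of the connected components of the underlying undirected graph:\<close>

definition components :: "('v, 'e) pre_digraph \<Rightarrow> 'v set set" where
  "components G = pre_digraph.sccs_verts (with_proj (mk_symmetric G))"

definition remove_arcs :: "('v, 'e) pre_digraph \<Rightarrow> 'e set \<Rightarrow> ('v, 'e) pre_digraph" where
  "remove_arcs G S = G\<lparr>arcs := arcs G - S\<rparr>"

definition disconnecting :: "('v, 'e) pre_digraph \<Rightarrow> 'e set \<Rightarrow> bool" where
  "disconnecting G S \<longleftrightarrow>
     S \<subseteq> arcs G \<and> card (components G) < card (components (remove_arcs G S))"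

definition is_cutset :: "('v, 'e) pre_digraph \<Rightarrow> 'e set \<Rightarrow> bool" where
  "is_cutset G S \<longleftrightarrow> disconnecting G S \<and> (\<forall>S'. S' \<subset> S \<longrightarrow> \<not> disconnecting G S')"

text \<open>The cutset \<open>S\<close> is oriented away from the component \<open>X\<close>.\<close>

definition cutset_row :: "('v, 'e) pre_digraph \<Rightarrow> 'e set \<Rightarrow> 'v set \<Rightarrow> real ^ 'e" where
  "cutset_row G S X = (\<chi> e.
     if e \<in> S \<and> tail G e \<in> X \<and> head G e \<notin> X then 1
     else if e \<in> S \<and> head G e \<in> X \<and> tail G e \<notin> X then - 1 else 0)"

definition independent_rows :: "'e set \<Rightarrow> real ^ 'e ^ 'e \<Rightarrow> bool" where
  "independent_rows K A \<longleftrightarrow> inj_on (\<lambda>i. row i A) K \<and> independent ((\<lambda>i. row i A) ` K)"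

text \<open>
  For a connected digraph with \<open>m\<close> arcs and \<open>n\<close> nodes, a reduced loop matrix has \<open>m - n + 1\<close> rows
  and a reduced cutset matrix has \<open>n - 1\<close> rows.  Only the rows with index in \<open>K\<close> belong to the
  matrix; since there are \<open>m\<close> rows in total, the rows of a pair of reduced loop and cutset matrices
  can be indexed by the complementary subsets \<open>K\<close> and \<open>- K\<close> of the type of arcs.  Which row index is
  assigned to which loop or cutset is immaterial.
\<close>

definition reduced_loop_matrix ::
  "('v, 'e) pre_digraph \<Rightarrow> 'e set \<Rightarrow> real ^ 'e ^ 'e \<Rightarrow> bool" where
  "reduced_loop_matrix G K B \<longleftrightarrow>
     card K + card (verts G) = card (arcs G) + 1 \<and>
     (\<forall>i\<in>K. \<exists>p. oriented_loop G p \<and> row i B = loop_row p) \<and> independent_rows K B"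

definition reduced_cutset_matrix ::
  "('v, 'e) pre_digraph \<Rightarrow> 'e set \<Rightarrow> real ^ 'e ^ 'e \<Rightarrow> bool" where
  "reduced_cutset_matrix G K Q \<longleftrightarrow>
     card K + 1 = card (verts G) \<and>
     (\<forall>i\<in>K. \<exists>S X. is_cutset G S \<and> X \<in> components (remove_arcs G S) - components G \<and>
        row i Q = cutset_row G S X) \<and> independent_rows K Q"

definition is_spanning_tree :: "('v, 'e) pre_digraph \<Rightarrow> 'e set \<Rightarrow> bool" where
  "is_spanning_tree G T \<longleftrightarrow>
     T \<subseteq> arcs G \<and> Digraph_Component.connected (G\<lparr>arcs := T\<rparr>) \<and> \<not> (\<exists>S\<subseteq>T. is_loop G S)"


section \<open>Devices, proper trees and MR-products\<close>

datatype device = Memristor | Capacitor | Inductor | Resistor | VSource | CSource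

definition proper_tree :: "('v, 'e) pre_digraph \<Rightarrow> ('e \<Rightarrow> device) \<Rightarrow> 'e set \<Rightarrow> bool" where
  "proper_tree G kind T \<longleftrightarrow> is_spanning_tree G T \<and>
     {e \<in> arcs G. kind e \<in> {VSource, Capacitor}} \<subseteq> T \<and>
     {e \<in> arcs G. kind e \<in> {CSource, Inductor}} \<inter> T = {}"

definition L_proper_tree :: "('v, 'e) pre_digraph \<Rightarrow> ('e \<Rightarrow> device) \<Rightarrow> 'e set \<Rightarrow> bool" where
  "L_proper_tree G kind T \<longleftrightarrow> is_spanning_tree G T \<and>
     {e \<in> arcs G. kind e \<in> {VSource, Inductor}} \<subseteq> T \<and>
     {e \<in> arcs G. kind e \<in> {CSource, Capacitor}} \<inter> T = {}"

text \<open>\<open>m\<close> is the memristance and \<open>r e\<close> the resistance of the resistor \<open>e\<close>.\<close>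

definition MR_product ::
  "('v, 'e) pre_digraph \<Rightarrow> ('e \<Rightarrow> device) \<Rightarrow> real \<Rightarrow> ('e \<Rightarrow> real) \<Rightarrow> 'e set \<Rightarrow> real" where
  "MR_product G kind m r T =
     (\<Prod>e \<in> {e \<in> arcs G - T. kind e \<in> {Memristor, Resistor}}.
        if kind e = Memristor then m else r e)"

definition C2_with_derivative :: "(real ^ 'e \<Rightarrow> real ^ 'e) \<Rightarrow> (real ^ 'e \<Rightarrow> real ^ 'e ^ 'e) \<Rightarrow> bool" where
  "C2_with_derivative f D \<longleftrightarrow>
     (\<forall>x. (f has_derivative (\<lambda>u. D x *v u)) (at x)) \<and>
     (\<exists>D' :: real ^ 'e \<Rightarrow> (real ^ 'e) \<Rightarrow>\<^sub>L (real ^ 'e ^ 'e).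
        (\<forall>x. (D has_derivative blinfun_apply (D' x)) (at x)) \<and> continuous_on UNIV D')"


section \<open>The circuit equations\<close>

text \<open>
  The type \<open>'e\<close> is the type of branches.  Every device class but the memristor may be empty, so
  the vectors of a class are not given types of their own: a vector indexed by the class \<open>k\<close> is a
  vector indexed by all branches which vanishes outside the class, and a square matrix indexed by
  \<open>k\<close> is extended by an identity block, which changes neither its determinant nor its inverse.
\<close>

definition on_class :: "('e \<Rightarrow> device) \<Rightarrow> device \<Rightarrow> real ^ 'e \<Rightarrow> real ^ 'e" where
  "on_class kind k w = (\<chi> e. if kind e = k then w $ e else 0)"

definition class_block :: "('e \<Rightarrow> device) \<Rightarrow> device \<Rightarrow> real ^ 'e ^ 'e \<Rightarrow> real ^ 'e ^ 'e" where
  "class_block kind k A = (\<chi> i j.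
     if kind i = k \<and> kind j = k then A $ i $ j else if i = j then 1 else 0)"

text \<open>
  The variable \<open>y\<close> has one entry for each memristor, capacitor and inductor; these branches are
  enumerated by \<open>dyn :: 'd \<Rightarrow> 'e\<close>.  The variable \<open>z\<close> has exactly one entry for every branch: the
  voltage for inductors and current sources, and the current for all other branches.  The pair
  \<open>(y, z)\<close> is a vector indexed by \<open>'d + 'e\<close>.
\<close>

definition enumerates_dynamic :: "('d \<Rightarrow> 'e) \<Rightarrow> ('e \<Rightarrow> device) \<Rightarrow> bool" where
  "enumerates_dynamic dyn kind \<longleftrightarrow>
     bij_betw dyn UNIV {e. kind e \<in> {Memristor, Capacitor, Inductor}}"

text \<open>The entry at a branch outside the range of \<open>dyn\<close> is irrelevant.\<close>

definition y_at :: "('d \<Rightarrow> 'e) \<Rightarrow> real ^ ('d::finite + 'e::finite) \<Rightarrow> real ^ 'e" where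
  "y_at dyn x = (\<chi> e. x $ Inl (inv dyn e))"

definition z_at :: "real ^ ('d::finite + 'e::finite) \<Rightarrow> real ^ 'e" where
  "z_at x = (\<chi> e. x $ Inr e)"

text \<open>The memristor charge \<open>q\<^sub>m\<close>, when there is a single memristor:\<close>

definition charge :: "('e \<Rightarrow> device) \<Rightarrow> ('d \<Rightarrow> 'e) \<Rightarrow> real ^ ('d::finite + 'e::finite) \<Rightarrow> real" where
  "charge kind dyn x = y_at dyn x $ (THE e. kind e = Memristor)"

definition cap_voltages :: "('e \<Rightarrow> device) \<Rightarrow> ('d \<Rightarrow> 'e) \<Rightarrow> real ^ ('d::finite + 'e::finite) \<Rightarrow> real ^ 'e" where
  "cap_voltages kind dyn x = on_class kind Capacitor (y_at dyn x)"

definition ind_currents :: "('e \<Rightarrow> device) \<Rightarrow> ('d \<Rightarrow> 'e) \<Rightarrow> real ^ ('d::finite + 'e::finite) \<Rightarrow> real ^ 'e" where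
  "ind_currents kind dyn x = on_class kind Inductor (y_at dyn x)"

definition res_currents :: "('e \<Rightarrow> device) \<Rightarrow> real ^ ('d::finite + 'e::finite) \<Rightarrow> real ^ 'e" where
  "res_currents kind x = on_class kind Resistor (z_at x)"

definition h_map ::
  "('e \<Rightarrow> device) \<Rightarrow> ('d \<Rightarrow> 'e) \<Rightarrow> (real ^ 'e \<Rightarrow> real ^ 'e ^ 'e) \<Rightarrow> (real ^ 'e \<Rightarrow> real ^ 'e ^ 'e) \<Rightarrow>
   real ^ ('d::finite + 'e::finite) \<Rightarrow> real ^ 'd" where
  "h_map kind dyn C L x = (\<chi> d. case kind (dyn d) of
       Memristor \<Rightarrow> z_at x $ dyn d
     | Capacitor \<Rightarrow> (matrix_inv (class_block kind Capacitor (C (cap_voltages kind dyn x)))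
                      *v on_class kind Capacitor (z_at x)) $ dyn d
     | Inductor \<Rightarrow> (matrix_inv (class_block kind Inductor (L (ind_currents kind dyn x)))
                      *v on_class kind Inductor (z_at x)) $ dyn d
     | _ \<Rightarrow> 0)"

definition branch_voltages ::
  "('e \<Rightarrow> device) \<Rightarrow> ('d \<Rightarrow> 'e) \<Rightarrow> (real \<Rightarrow> real) \<Rightarrow> (real ^ 'e \<Rightarrow> real ^ 'e) \<Rightarrow> real ^ 'e \<Rightarrow>
   real ^ ('d::finite + 'e::finite) \<Rightarrow> real ^ 'e" where
  "branch_voltages kind dyn M \<gamma> V x = (\<chi> e. case kind e of
       Memristor \<Rightarrow> M (charge kind dyn x) * z_at x $ e
     | Capacitor \<Rightarrow> y_at dyn x $ e
     | Inductor \<Rightarrow> z_at x $ e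
     | Resistor \<Rightarrow> \<gamma> (res_currents kind x) $ e
     | VSource \<Rightarrow> V $ e
     | CSource \<Rightarrow> z_at x $ e)"

definition branch_currents ::
  "('e \<Rightarrow> device) \<Rightarrow> ('d \<Rightarrow> 'e) \<Rightarrow> real ^ 'e \<Rightarrow> real ^ ('d::finite + 'e::finite) \<Rightarrow> real ^ 'e" where
  "branch_currents kind dyn I x = (\<chi> e. case kind e of
       Memristor \<Rightarrow> z_at x $ e
     | Capacitor \<Rightarrow> z_at x $ e
     | Inductor \<Rightarrow> y_at dyn x $ e
     | Resistor \<Rightarrow> z_at x $ e
     | VSource \<Rightarrow> z_at x $ e
     | CSource \<Rightarrow> I $ e)"

text \<open>Kirchhoff's voltage law in the rows \<open>K\<close>, his current law in the remaining rows:\<close>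

definition g_map ::
  "('e \<Rightarrow> device) \<Rightarrow> ('d \<Rightarrow> 'e) \<Rightarrow> 'e set \<Rightarrow> real ^ 'e ^ 'e \<Rightarrow> real ^ 'e ^ 'e \<Rightarrow>
   (real \<Rightarrow> real) \<Rightarrow> (real ^ 'e \<Rightarrow> real ^ 'e) \<Rightarrow> real ^ 'e \<Rightarrow> real ^ 'e \<Rightarrow>
   real ^ ('d::finite + 'e::finite) \<Rightarrow> real ^ 'e" where
  "g_map kind dyn K B Q M \<gamma> V I x = (\<chi> i.
     if i \<in> K then (B *v branch_voltages kind dyn M \<gamma> V x) $ i
     else (Q *v branch_currents kind dyn I x) $ i)"

definition stack :: "real ^ 'd \<Rightarrow> real ^ 'e \<Rightarrow> real ^ ('d::finite + 'e::finite)" where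
  "stack a b = (\<chi> i. case i of Inl d \<Rightarrow> a $ d | Inr e \<Rightarrow> b $ e)"

text \<open>The polynomial \<open>det (\<lambda> E - A)\<close>, where \<open>E\<close> is the identity on the block \<open>'d\<close> and zero elsewhere:\<close>

definition pencil_poly :: "real ^ ('d::finite + 'e::finite) ^ ('d + 'e) \<Rightarrow> real poly" where
  "pencil_poly A = det (\<chi> i j. [: - (A $ i $ j), (if i = j \<and> isl i then 1 else 0) :])"

end

theory Submission
  imports Defs
begin

text \<open>
  At an equilibrium \<open>i\<^sub>m\<close>, \<open>i\<^sub>c\<close> and \<open>v\<^sub>l\<close> vanish, so the derivatives of the memristance and of the
  capacitance and inductance matrices drop out: the linearisation is again a circuit, of linear
  devices, with the sources switched off.  The memristor charge does not occur in its equations.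
  Thus the charge direction is an eigenvector for the eigenvalue zero, and the point is to find a second
  vector: a non-zero solution of the linearised equations in which all rates of change vanish, except
  possibly that of the charge (\<open>pencil_poly_double_zero\<close>).

  Such a solution has \<open>i\<^sub>c = 0\<close> and \<open>v\<^sub>l = 0\<close>.  As resistors are uncoupled, each branch is left with one
  free variable \<open>w\<close>, in terms of which its voltage is \<open>b w\<close> and its current \<open>q w\<close> with coefficients
  \<open>b, q\<close> that are \<open>0\<close>, \<open>1\<close>, a resistance or the memristance.  Kirchhoff's laws form a square system
  in \<open>w\<close>, whose determinant is a non-zero constant times the sum, over all spanning trees, of the
  product of \<open>q\<close> over the tree and of \<open>b\<close> over the co-tree (\<open>det_scaled_kirchhoff_matrix\<close>).  The
  trees with a non-zero contribution are the L-proper ones, and they contribute their MR-products; so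
  the system is singular and the second vector exists.  If, instead, the dynamic variables
  are kept fixed, capacitors and inductors exchange their roles and the determinant becomes the sum over
  proper trees.  Therefore the algebraic equations can be solved for \<open>z\<close>, and the pencil polynomial
  is not identically zero (\<open>pencil_poly_nonzero\<close>).

  In the tree formula the essential claim is that all spanning trees contribute with the
  same constant, including its sign (\<open>det_tree_selection\<close>).  The determinant of the stacked loop and cutset
  matrices is the contribution of the tree \<open>T\<close> times the determinant of the matrix \<open>W\<close> whose rows are the
  fundamental cycles and cuts of \<open>T\<close>.  Since \<open>W\<close> is the identity plus a skew-symmetric matrix, its
  determinant is positive; since the fundamental bases of different trees are related by integral
  matrices, it is the same for all trees (\<open>det_fundamental_matrix_unique\<close>).
\<close>

section \<open>Determinants with scaled blocks of rows\<close>

lemma sum_Pow_insert: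
  assumes "finite F" "k \<notin> F"
  shows "sum g (Pow (insert k F)) = (\<Sum>T\<in>Pow F. g (insert k T)) + (\<Sum>T\<in>Pow F. g T :: real)"
proof -
  have "inj_on (insert k) (Pow F)" using assms by (auto simp: inj_on_def)
  then show ?thesis using assms
    by (subst Pow_insert, subst sum.union_disjoint) (auto simp: sum.reindex add.commute)
qed

lemma det_rows_add_expand:
  fixes u v c :: "'n::finite \<Rightarrow> real ^ 'n"
  assumes "finite F"
  shows "det (\<chi> i. if i \<in> F then u i + v i else c i)
       = (\<Sum>T\<in>Pow F. det (\<chi> i. if i \<in> F then (if i \<in> T then u i else v i) else c i))"
  using assms
proof (induction F arbitrary: c rule: finite_induct)
  case empty
  show ?case by simp
next
  case (insert k F)
  let ?r = "\<lambda>w i. if i = k then w else c i"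
  let ?D = "\<lambda>F c T. det (\<chi> i. if i \<in> F then (if i \<in> T then u i else v i) else c i)"
  have move: "det (\<chi> i. if i = k then w else if i \<in> F then u i + v i else c i)
      = (\<Sum>T\<in>Pow F. ?D F (?r w) T)" for w
  proof -
    have "(\<chi> i. if i = k then w else if i \<in> F then u i + v i else c i)
        = (\<chi> i. if i \<in> F then u i + v i else ?r w i)"
      using insert.hyps by (intro Cart_lambda_cong) auto
    then show ?thesis by (simp only: insert.IH)
  qed
  have with_k: "?D F (?r (u k)) T = ?D (insert k F) c (insert k T)" for T
    using insert.hyps by (intro arg_cong[where f = det] Cart_lambda_cong) auto
  have without_k: "?D F (?r (v k)) T = ?D (insert k F) c T" if "T \<in> Pow F" for T
  proof -
    have "k \<notin> T" using that insert.hyps by auto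
    then show ?thesis by (intro arg_cong[where f = det] Cart_lambda_cong) auto
  qed
  have "det (\<chi> i. if i \<in> insert k F then u i + v i else c i)
      = det (\<chi> i. if i = k then u k + v k else if i \<in> F then u i + v i else c i)"
    by (intro arg_cong[where f = det] Cart_lambda_cong) auto
  also have "\<dots> = det (\<chi> i. if i = k then u k else if i \<in> F then u i + v i else c i)
      + det (\<chi> i. if i = k then v k else if i \<in> F then u i + v i else c i)"
    by (rule det_row_add)
  also have "\<dots> = (\<Sum>T\<in>Pow F. ?D F (?r (u k)) T) + (\<Sum>T\<in>Pow F. ?D F (?r (v k)) T)"
    by (simp only: move)
  also have "\<dots> = (\<Sum>T\<in>Pow F. ?D (insert k F) c (insert k T)) + (\<Sum>T\<in>Pow F. ?D (insert k F) c T)"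
    by (simp only: with_k without_k cong: sum.cong)
  also have "\<dots> = (\<Sum>T\<in>Pow (insert k F). ?D (insert k F) c T)"
    by (rule sum_Pow_insert[OF insert.hyps, symmetric])
  finally show ?case .
qed

text \<open>
  If the rows in \<open>K\<close> form a loop matrix \<open>B\<close> and the other rows a cutset matrix \<open>Q\<close>, this keeps the columns
  of \<open>B\<close> off \<open>T\<close> and the columns of \<open>Q\<close> in \<open>T\<close>, so that its determinant is, up to sign, the product of the
  corresponding two minors (which are square only for the right size of \<open>T\<close>).
\<close>

definition tree_selection :: "'e set \<Rightarrow> 'e set \<Rightarrow> real ^ 'e ^ 'e \<Rightarrow> real ^ 'e ^ 'e" where
  "tree_selection K T S = (\<chi> i e. if (i \<in> K) = (e \<notin> T) then S $ i $ e else 0)"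

text \<open>
  Every column is the sum of its part in \<open>K\<close>, scaled by \<open>b\<close>, and its part outside \<open>K\<close>, scaled by \<open>q\<close>.
  Expanding multilinearly, \<open>T\<close> records the columns in which the second part is chosen.  This takes the
  place of a Laplace expansion and leaves no signs to keep track of.
\<close>

lemma det_block_scaling:
  fixes S :: "real ^ 'e::finite ^ 'e" and b q :: "'e \<Rightarrow> real"
  shows "det (\<chi> i e. (if i \<in> K then b e else q e) * S $ i $ e)
       = (\<Sum>T\<in>UNIV. (\<Prod>e\<in>T. q e) * (\<Prod>e\<in>-T. b e) * det (tree_selection K T S))"
proof -
  let ?u = "\<lambda>e. q e *s (\<chi> i. if i \<in> K then 0 else S $ i $ e)"
  let ?v = "\<lambda>e. b e *s (\<chi> i. if i \<in> K then S $ i $ e else 0)"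
  have *: "det (\<chi> e. if e \<in> T then ?u e else ?v e)
      = (\<Prod>e\<in>T. q e) * (\<Prod>e\<in>-T. b e) * det (tree_selection K T S)" for T
  proof -
    have "(\<chi> e. if e \<in> T then ?u e else ?v e)
        = (\<chi> e. (if e \<in> T then q e else b e) *s (transpose (tree_selection K T S) $ e))"
      by (auto simp: vec_eq_iff tree_selection_def transpose_def)
    then have "det (\<chi> e. if e \<in> T then ?u e else ?v e)
        = (\<Prod>e\<in>UNIV. if e \<in> T then q e else b e) * det (\<chi> e. transpose (tree_selection K T S) $ e)"
      by (simp only: det_rows_mul)
    also have "(\<chi> e. transpose (tree_selection K T S) $ e) = transpose (tree_selection K T S)"
      by simp
    also have "(\<Prod>e\<in>UNIV. if e \<in> T then q e else b e) = (\<Prod>e\<in>T. q e) * (\<Prod>e\<in>-T. b e)"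
      by (subst prod.If_cases) (auto simp: Collect_neg_eq[symmetric] Compl_eq)
    finally show ?thesis by simp
  qed
  have "det (\<chi> i e. (if i \<in> K then b e else q e) * S $ i $ e)
      = det (transpose (\<chi> i e. (if i \<in> K then b e else q e) * S $ i $ e))"
    by simp
  also have "transpose (\<chi> i e. (if i \<in> K then b e else q e) * S $ i $ e)
      = (\<chi> e. if e \<in> UNIV then ?u e + ?v e else 0)"
    by (auto simp: vec_eq_iff transpose_def)
  also have "det \<dots> = (\<Sum>T\<in>Pow UNIV. det (\<chi> e. if e \<in> UNIV then (if e \<in> T then ?u e else ?v e) else 0))"
    by (rule det_rows_add_expand) simp
  also have "\<dots> = (\<Sum>T\<in>UNIV. (\<Prod>e\<in>T. q e) * (\<Prod>e\<in>-T. b e) * det (tree_selection K T S))"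
    using * by (intro sum.cong) auto
  finally show ?thesis .
qed

section \<open>Fundamental bases of a cycle space\<close>

text \<open>
  The abstract counterpart of a spanning tree \<open>T\<close>: the space \<open>Z\<close> of circulations has an integral basis
  \<open>c a\<close> indexed by the co-tree, where \<open>c a\<close> runs once through \<open>a\<close> and otherwise only through \<open>T\<close>.
  Only the zero circulation is supported on \<open>T\<close>.
\<close>

definition fundamental_basis :: "(real ^ 'e) set \<Rightarrow> 'e set \<Rightarrow> ('e \<Rightarrow> real ^ 'e) \<Rightarrow> bool" where
  "fundamental_basis Z T c \<longleftrightarrow>
     (\<forall>a. a \<notin> T \<longrightarrow> c a \<in> Z \<and> (\<forall>b. b \<notin> T \<longrightarrow> c a $ b = (if a = b then 1 else 0)) \<and> (\<forall>b. c a $ b \<in> \<int>)) \<and>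
     (\<forall>z\<in>Z. (\<forall>e. e \<notin> T \<longrightarrow> z $ e = 0) \<longrightarrow> z = 0)"

text \<open>
  The row of a co-tree branch is its fundamental cycle, the row of a tree branch its fundamental cut.
  By duality the latter is read off from the cycles, so that the matrix is the identity plus a
  skew-symmetric matrix.
\<close>

definition fundamental_matrix :: "'e set \<Rightarrow> ('e \<Rightarrow> real ^ 'e) \<Rightarrow> real ^ 'e ^ 'e" where
  "fundamental_matrix T c = (\<chi> a e. (if a = e then 1 else 0)
     + (if a \<notin> T \<and> e \<in> T then c a $ e else 0) - (if a \<in> T \<and> e \<notin> T then c e $ a else 0))"

lemma fundamental_basis_expansion:
  assumes "subspace Z" "fundamental_basis Z T c" "z \<in> Z"
  shows "z = (\<Sum>a\<in>-T. z $ a *\<^sub>R c (a :: 'e::finite))"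
proof -
  let ?s = "\<Sum>a\<in>-T. z $ a *\<^sub>R c a"
  have "?s \<in> Z"
    using assms by (intro subspace_sum subspace_scale) (auto simp: fundamental_basis_def)
  then have "z - ?s \<in> Z" using assms subspace_diff by blast
  moreover have "(z - ?s) $ e = 0" if "e \<notin> T" for e
  proof -
    have "?s $ e = (\<Sum>a\<in>-T. z $ a * c a $ e)" by simp
    also have "\<dots> = (\<Sum>a\<in>-T. if a = e then z $ a else 0)"
      using assms(2) that by (intro sum.cong) (auto simp: fundamental_basis_def)
    also have "\<dots> = z $ e" using that by (subst sum.delta) auto
    finally show ?thesis by simp
  qed
  ultimately have "z - ?s = 0" using assms(2) unfolding fundamental_basis_def by blast
  then show ?thesis by (rule eq_iff_diff_eq_0[THEN iffD2])
qed

lemma fundamental_matrix_cycle_row: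
  assumes "fundamental_basis Z T c" "a \<notin> T"
  shows "fundamental_matrix T c $ a = c a"
  using assms by (auto simp: vec_eq_iff fundamental_matrix_def fundamental_basis_def)

text \<open>
  Orthogonality to the fundamental cycle through \<open>a\<close> determines the entry at \<open>a\<close> from those in the tree.
\<close>

lemma orthogonal_off_tree:
  fixes T :: "'e::finite set"
  assumes "fundamental_basis Z T c" "\<And>z. z \<in> Z \<Longrightarrow> q \<bullet> z = 0" "a \<notin> T"
  shows "q $ a = - (\<Sum>e\<in>T. q $ e * c a $ e)"
proof -
  have "0 = q \<bullet> c a" using assms by (auto simp: fundamental_basis_def)
  also have "\<dots> = (\<Sum>e\<in>T. q $ e * c a $ e) + (\<Sum>e\<in>-T. q $ e * c a $ e)"
    by (simp add: inner_vec_def Compl_eq_Diff_UNIV add.commute sum.subset_diff[of T UNIV])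
  also have "(\<Sum>e\<in>-T. q $ e * c a $ e) = (\<Sum>e\<in>-T. if e = a then q $ e else 0)"
    using assms by (intro sum.cong) (auto simp: fundamental_basis_def)
  also have "\<dots> = q $ a" using assms(3) by (subst sum.delta) auto
  finally show ?thesis by simp
qed

text \<open>
  Circulations are determined by their co-tree entries, and vectors orthogonal to all circulations by
  their tree entries.  Hence a matrix whose rows are of these two kinds is recovered from its selection
  along \<open>T\<close>, which contains just the coefficients of its rows with respect to the fundamental cycles and cuts.
\<close>

lemma tree_selection_mult_fundamental_matrix:
  fixes S :: "real ^ 'e::finite ^ 'e"
  assumes "subspace Z" "fundamental_basis Z T c"
    and "\<And>i. i \<in> K \<Longrightarrow> S $ i \<in> Z"
    and "\<And>i z. i \<notin> K \<Longrightarrow> z \<in> Z \<Longrightarrow> S $ i \<bullet> z = 0"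
  shows "tree_selection K T S ** fundamental_matrix T c = S"
proof -
  have "(tree_selection K T S ** fundamental_matrix T c) $ i $ j = S $ i $ j" for i j
  proof (cases "i \<in> K")
    case True
    have "(tree_selection K T S ** fundamental_matrix T c) $ i $ j
        = (\<Sum>e\<in>UNIV. if e \<in> -T then S $ i $ e * c e $ j else 0)"
      using True fundamental_matrix_cycle_row[OF assms(2)]
      by (auto simp: matrix_matrix_mult_def tree_selection_def intro!: sum.cong)
    also have "\<dots> = (\<Sum>e\<in>-T. S $ i $ e * c e $ j)"
      by (simp add: sum.If_cases Compl_eq)
    also have "\<dots> = (\<Sum>a\<in>-T. S $ i $ a *\<^sub>R c a) $ j"
      by simp
    also have "\<dots> = S $ i $ j"
      by (simp only: fundamental_basis_expansion[OF assms(1,2) assms(3)[OF True], symmetric])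
    finally show ?thesis .
  next
    case False
    have "(tree_selection K T S ** fundamental_matrix T c) $ i $ j
        = (\<Sum>e\<in>UNIV. if e \<in> T then S $ i $ e * fundamental_matrix T c $ e $ j else 0)"
      using False by (auto simp: matrix_matrix_mult_def tree_selection_def intro!: sum.cong)
    also have "\<dots> = (\<Sum>e\<in>T. S $ i $ e * fundamental_matrix T c $ e $ j)"
      by (simp add: sum.If_cases)
    also have "\<dots> = S $ i $ j"
    proof (cases "j \<in> T")
      case True
      then have "(\<Sum>e\<in>T. S $ i $ e * fundamental_matrix T c $ e $ j)
          = (\<Sum>e\<in>T. if e = j then S $ i $ e else 0)"
        by (intro sum.cong) (auto simp: fundamental_matrix_def)
      then show ?thesis using True by (simp add: sum.delta)
    next
      case j: False
      then have "(\<Sum>e\<in>T. S $ i $ e * fundamental_matrix T c $ e $ j)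
          = (\<Sum>e\<in>T. - (S $ i $ e * c j $ e))"
        by (intro sum.cong) (auto simp: fundamental_matrix_def)
      then show ?thesis
        using orthogonal_off_tree[OF assms(2) assms(4)[OF False] j] by (simp add: sum_negf)
    qed
    finally show ?thesis .
  qed
  then show ?thesis by (simp add: vec_eq_iff)
qed

lemma det_nonzero_iff_ker:
  fixes A :: "real ^ 'n::finite ^ 'n"
  shows "det A \<noteq> 0 \<longleftrightarrow> (\<forall>x. A *v x = 0 \<longrightarrow> x = 0)"
  by (metis invertible_det_nz invertible_left_inverse matrix_left_invertible_ker)

lemma det_Ints:
  fixes A :: "real ^ 'n::finite ^ 'n"
  assumes "\<And>i j. A $ i $ j \<in> \<int>"
  shows "det A \<in> \<int>"
  unfolding det_def using assms by (intro Ints_sum Ints_mult Ints_prod) auto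

text \<open>
  On the segment from the identity to this matrix all matrices have symmetric part \<open>1\<close>, hence
  trivial kernel, and the determinant cannot change sign.
\<close>

lemma det_fundamental_matrix_pos: "det (fundamental_matrix T c :: real ^ 'e::finite ^ 'e) > 0"
proof (rule ccontr)
  let ?W = "fundamental_matrix T c"
  define A where "A t = (\<chi> i j. (1 - t) * mat 1 $ i $ j + t * ?W $ i $ j)" for t :: real
  assume "\<not> det ?W > 0"
  moreover have "A 1 = ?W" "A 0 = mat 1" by (auto simp: A_def vec_eq_iff)
  ultimately have "det (A 1) \<le> 0" "0 \<le> det (A 0)" by auto
  moreover have "continuous_on {0..1} (\<lambda>t. det (A t))"
    unfolding det_def A_def by (intro continuous_intros)
  ultimately obtain t where t: "det (A t) = 0"
    using IVT2'[of "\<lambda>t. det (A t)" 1 0 0] by auto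
  then obtain x where x: "x \<noteq> 0" "A t *v x = 0" using det_nonzero_iff_ker by blast
  have entry: "A t $ i $ j = (if i = j then 1 else 0) +
      (t * (if i \<notin> T \<and> j \<in> T then c i $ j else 0) - t * (if j \<notin> T \<and> i \<in> T then c j $ i else 0))" for i j
    by (auto simp: A_def fundamental_matrix_def mat_def algebra_simps)
  let ?s = "\<lambda>i j. x $ i * x $ j * (t * (if i \<notin> T \<and> j \<in> T then c i $ j else 0))"
  have "0 = x \<bullet> (A t *v x)" using x by simp
  also have "\<dots> = (\<Sum>i\<in>UNIV. \<Sum>j\<in>UNIV. x $ i * (A t $ i $ j * x $ j))"
    by (simp add: inner_vec_def matrix_vector_mult_def sum_distrib_left)
  also have "\<dots> = (\<Sum>i\<in>UNIV. \<Sum>j\<in>UNIV. (if i = j then x $ i * x $ j else 0) + (?s i j - ?s j i))"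
    unfolding entry by (intro sum.cong refl) (auto simp: algebra_simps)
  also have "\<dots> = (\<Sum>i\<in>UNIV. x $ i * x $ i) + ((\<Sum>i\<in>UNIV. \<Sum>j\<in>UNIV. ?s i j) - (\<Sum>i\<in>UNIV. \<Sum>j\<in>UNIV. ?s j i))"
    by (simp add: sum.distrib sum_subtractf)
  also have "(\<Sum>i\<in>UNIV. \<Sum>j\<in>UNIV. ?s j i) = (\<Sum>i\<in>UNIV. \<Sum>j\<in>UNIV. ?s i j)"
    by (rule sum.swap)
  finally have "x \<bullet> x = 0" by (simp add: inner_vec_def)
  then show False using x by simp
qed

lemma fundamental_matrix_Ints:
  assumes "fundamental_basis Z T c"
  shows "fundamental_matrix T c $ i $ j \<in> \<int>"
  using assms by (auto simp: fundamental_matrix_def fundamental_basis_def)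

lemma fundamental_cut_orthogonal:
  fixes T :: "'e::finite set"
  assumes "subspace Z" "fundamental_basis Z T c" "e \<in> T" "z \<in> Z"
  shows "fundamental_matrix T c $ e \<bullet> z = 0"
proof -
  have "fundamental_matrix T c $ e \<bullet> c a = 0" if "a \<notin> T" for a
  proof -
    have "fundamental_matrix T c $ e $ j * c a $ j =
      (if j = e then c a $ j else 0) - (if j = a then c a $ e else 0)" for j
      using assms(2,3) that by (auto simp: fundamental_matrix_def fundamental_basis_def)
    then show ?thesis by (simp add: inner_vec_def sum_subtractf)
  qed
  then show ?thesis
    by (subst fundamental_basis_expansion[OF assms(1,2,4)]) (simp add: inner_sum_right)
qed

text \<open>
  For a graph this determinant is the number of spanning trees.  The independence of \<open>T\<close> has a shorter
  reason: the change from one fundamental basis to another is an integral matrix in both directions,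
  so each of the two positive determinants is a positive integral multiple of the other.
\<close>

lemma det_fundamental_matrix_unique:
  fixes T T' :: "'e::finite set"
  assumes "subspace Z" and T: "fundamental_basis Z T c" and T': "fundamental_basis Z T' c'"
  shows "det (fundamental_matrix T c) = det (fundamental_matrix T' c')"
proof -
  have *: "\<exists>n\<in>\<int>. n * det (fundamental_matrix U d) = det (fundamental_matrix U' d')"
    if U: "fundamental_basis Z U d" and U': "fundamental_basis Z U' d'" for U U' :: "'e set" and d d'
  proof -
    let ?N = "tree_selection (- U') U (fundamental_matrix U' d')"
    have "?N ** fundamental_matrix U d = fundamental_matrix U' d'"
    proof (rule tree_selection_mult_fundamental_matrix[OF \<open>subspace Z\<close> U])
      show "fundamental_matrix U' d' $ i \<in> Z" if "i \<in> - U'" for i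
        using that U' fundamental_matrix_cycle_row[OF U'] by (simp add: fundamental_basis_def)
      show "fundamental_matrix U' d' $ i \<bullet> z = 0" if "i \<notin> - U'" "z \<in> Z" for i z
        using that fundamental_cut_orthogonal[OF \<open>subspace Z\<close> U'] by simp
    qed
    from arg_cong[OF this, of det]
    have "det ?N * det (fundamental_matrix U d) = det (fundamental_matrix U' d')"
      by (simp only: det_mul)
    moreover have "det ?N \<in> \<int>"
      using fundamental_matrix_Ints[OF U'] by (intro det_Ints) (auto simp: tree_selection_def)
    ultimately show ?thesis by blast
  qed
  have le: "x \<le> y" if pos: "0 < x" "0 < y" and mult: "\<exists>n\<in>\<int>. n * x = y" for x y :: real
  proof -
    obtain n where n: "n \<in> \<int>" "n * x = y" using mult by blast
    obtain k where k: "n = of_int k" using n(1) by (rule Ints_cases)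
    have "0 < n * x" using n(2) pos(2) by simp
    then have "0 < n" using pos(1) by (simp add: zero_less_mult_iff)
    then have "1 \<le> n" unfolding k by simp
    then have "1 * x \<le> n * x" using pos(1) by (intro mult_right_mono) auto
    then show ?thesis using n(2) by simp
  qed
  show ?thesis
    by (intro antisym le *[OF T T'] *[OF T' T] det_fundamental_matrix_pos)
qed

section \<open>Circulations, tensions and spanning trees of a digraph\<close>

text \<open>
  In this sign convention the cutset row oriented away from \<open>X\<close> is the tension of the negated
  indicator of \<open>X\<close>.
\<close>

definition tension :: "('v, 'e) pre_digraph \<Rightarrow> ('v \<Rightarrow> real) \<Rightarrow> real ^ 'e" where
  "tension G f = (\<chi> e. f (head G e) - f (tail G e))"

definition circulations :: "('v, 'e::finite) pre_digraph \<Rightarrow> (real ^ 'e) set" where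
  "circulations G = {z. \<forall>f. z \<bullet> tension G f = 0}"

lemma subspace_circulations: "subspace (circulations G)"
  by (auto simp: subspace_def circulations_def inner_add_left)

definition step_vector :: "'e \<times> bool \<Rightarrow> real ^ 'e::finite" where
  "step_vector s = (if snd s then axis (fst s) 1 else - axis (fst s) 1)"

lemma step_vector_tension: "step_vector s \<bullet> tension G f = f (step_head G s) - f (step_tail G s)"
  by (auto simp: step_vector_def step_head_def step_tail_def tension_def inner_axis')

lemma loop_row_eq_sum_list:
  assumes "distinct (map fst p)"
  shows "loop_row p = sum_list (map step_vector p)"
  using assms
proof (induction p)
  case Nil
  show ?case by (simp add: loop_row_def vec_eq_iff)
next
  case (Cons s p)
  have "(fst s, b) \<notin> set p" for b
    using Cons.prems image_eqI[of "fst s" fst "(fst s, b)" "set p"] by auto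
  then have "loop_row (s # p) = step_vector s + loop_row p"
    by (cases s) (auto simp: vec_eq_iff loop_row_def step_vector_def axis_def)
  with Cons show ?case by simp
qed

text \<open>
  The scalar product of a loop with a tension is a telescoping sum over the steps.
\<close>

lemma loop_row_circulation:
  assumes "oriented_loop G p"
  shows "loop_row p \<in> circulations G"
proof -
  have sum_list_inner: "sum_list (map step_vector q) \<bullet> y = sum_list (map (\<lambda>s. step_vector s \<bullet> y) q)"
    for q :: "('b \<times> bool) list" and y
    by (induction q) (auto simp: inner_add_left)
  have "loop_row p \<bullet> tension G f = 0" for f
  proof -
    have "loop_row p \<bullet> tension G f = sum_list (map (\<lambda>s. step_vector s \<bullet> tension G f) p)"
      using assms by (simp add: oriented_loop_def loop_row_eq_sum_list sum_list_inner)
    also have "\<dots> = sum_list (map f (map (step_head G) p)) - sum_list (map f (map (step_tail G) p))"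
      by (simp add: step_vector_tension sum_list_subtractf o_def)
    also have "map (step_head G) p = rotate1 (map (step_tail G) p)"
      using assms by (simp add: oriented_loop_def)
    also have "sum_list (map f (rotate1 (map (step_tail G) p))) = sum_list (map f (map (step_tail G) p))"
      by (cases p) auto
    finally show ?thesis by simp
  qed
  then show ?thesis by (simp add: circulations_def)
qed

definition adjacency :: "('v, 'e) pre_digraph \<Rightarrow> 'e set \<Rightarrow> 'v rel" where
  "adjacency G T = {(step_tail G s, step_head G s) | s. fst s \<in> T}"

lemma adjacency_sym: "sym (adjacency G T)"
proof (rule symI)
  fix u v assume "(u, v) \<in> adjacency G T"
  then obtain e b where "e \<in> T" "u = step_tail G (e, b)" "v = step_head G (e, b)"
    by (auto simp: adjacency_def)
  then have "e \<in> T" "v = step_tail G (e, \<not> b)" "u = step_head G (e, \<not> b)"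
    by (auto simp: step_tail_def step_head_def)
  then show "(v, u) \<in> adjacency G T" unfolding adjacency_def by force
qed

lemma adjacency_iff:
  "(u, v) \<in> adjacency G T \<longleftrightarrow> (\<exists>e\<in>T. \<exists>b. u = step_tail G (e, b) \<and> v = step_head G (e, b))"
  unfolding adjacency_def by (simp add: split_paired_Ex) blast

lemma parcs_mk_symmetric: "parcs (mk_symmetric G) = adjacency G (arcs G)"
proof -
  have "(u, v) \<in> parcs (mk_symmetric G) \<longleftrightarrow> (u, v) \<in> adjacency G (arcs G)" for u v
    unfolding mk_symmetric_def step_tail_def step_head_def ex_bool_eq adjacency_iff by auto
  then show ?thesis by auto
qed

lemma adjacency_arcs_update [simp]: "adjacency (G\<lparr>arcs := S\<rparr>) T = adjacency G T"
  by (simp add: adjacency_def step_tail_def step_head_def)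

lemma in_adjacency: "e \<in> T \<Longrightarrow> (tail G e, head G e) \<in> adjacency G T"
  unfolding adjacency_def step_tail_def step_head_def by force

text \<open>
  An arc that has not been removed joins vertices of the same component.  All arcs that cross the boundary
  of a component are therefore in the cutset, which is what makes a cutset row a tension.
\<close>

lemma component_closed:
  assumes "X \<in> components (remove_arcs G S)" "e \<in> arcs G" "e \<notin> S"
    and "head G e \<in> verts G" "tail G e \<in> verts G"
  shows "tail G e \<in> X \<longleftrightarrow> head G e \<in> X"
proof -
  let ?H = "with_proj (mk_symmetric (remove_arcs G S))"
  have reach: "reachable ?H u v" if "(u, v) \<in> adjacency G (arcs G - S)" "u \<in> verts G" "v \<in> verts G" for u v
    unfolding reachable_def
  proof (rule rtrancl_on_into_rtrancl_on)
    show "(u, u) \<in> rtrancl_on (verts ?H) (arcs_ends ?H)"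
      using that by (simp add: remove_arcs_def)
    have "(u, v) \<in> parcs (mk_symmetric (remove_arcs G S))"
      using that by (simp add: parcs_mk_symmetric remove_arcs_def)
    then show "(u, v) \<in> arcs_ends ?H" by simp
    show "v \<in> verts ?H" using that by (simp add: remove_arcs_def)
  qed
  have "(tail G e, head G e) \<in> adjacency G (arcs G - S)" using assms by (intro in_adjacency) auto
  moreover from this have "(head G e, tail G e) \<in> adjacency G (arcs G - S)"
    using adjacency_sym by (rule symD[rotated])
  ultimately have "reachable ?H (tail G e) (head G e)" "reachable ?H (head G e) (tail G e)"
    using reach assms by auto
  then show ?thesis
    using assms(1) unfolding components_def pre_digraph.sccs_verts_def by blast
qed

lemma cutset_row_eq_tension:
  assumes "X \<in> components (remove_arcs G S)" "arcs G = UNIV" "wf_digraph G"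
  shows "cutset_row G S X = tension G (\<lambda>v. - indicator X v)"
proof -
  have "tail G e \<in> X \<longleftrightarrow> head G e \<in> X" if "e \<notin> S" for e
    using assms that wf_digraph.head_in_verts[OF assms(3), of e] wf_digraph.tail_in_verts[OF assms(3), of e]
    by (intro component_closed) auto
  then show ?thesis
    by (auto simp: vec_eq_iff cutset_row_def tension_def indicator_def)
qed

lemma connected_iff_adjacency:
  assumes "wf_digraph G" "arcs G = UNIV"
  shows "Digraph_Component.connected (G\<lparr>arcs := T\<rparr>) \<longleftrightarrow>
    verts G \<noteq> {} \<and> (\<forall>u\<in>verts G. \<forall>v\<in>verts G. (u, v) \<in> (adjacency G T)\<^sup>*)"
proof -
  let ?H = "with_proj (mk_symmetric (G\<lparr>arcs := T\<rparr>))"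
  have verts: "verts ?H = verts G" by (simp add: mk_symmetric_def)
  have ends: "arcs_ends ?H = adjacency G T"
    by (simp add: parcs_mk_symmetric)
  have "head G e \<in> verts G" "tail G e \<in> verts G" for e
    using wf_digraph.head_in_verts[OF assms(1)] wf_digraph.tail_in_verts[OF assms(1)] assms(2) by auto
  then have closed: "v \<in> verts G" if "(u, v) \<in> adjacency G T" for u v
    using that by (auto simp: adjacency_def step_head_def)
  have "reachable ?H u v \<longleftrightarrow> (u, v) \<in> (adjacency G T)\<^sup>*" if "u \<in> verts G" "v \<in> verts G" for u v
    unfolding reachable_def verts ends
  proof
    show "(u, v) \<in> (adjacency G T)\<^sup>*" if "(u, v) \<in> rtrancl_on (verts G) (adjacency G T)"
      using that by (rule rtrancl_on_rtranclI)
    show "(u, v) \<in> rtrancl_on (verts G) (adjacency G T)" if "(u, v) \<in> (adjacency G T)\<^sup>*"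
      by (rule rtrancl_consistent_rtrancl_on) (use that \<open>u \<in> verts G\<close> \<open>v \<in> verts G\<close> closed in auto)
  qed
  then have "(\<forall>u\<in>verts G. \<forall>v\<in>verts G. reachable ?H u v) \<longleftrightarrow>
      (\<forall>u\<in>verts G. \<forall>v\<in>verts G. (u, v) \<in> (adjacency G T)\<^sup>*)"
    by (intro ball_cong) auto
  then show ?thesis
    unfolding Digraph_Component.connected_def strongly_connected_def verts by (rule arg_cong)
qed

lemma tension_const_on_connected:
  assumes "(u, v) \<in> (adjacency G T)\<^sup>*" "\<And>e. e \<in> T \<Longrightarrow> tension G f $ e = 0"
  shows "f u = f v"
  using assms(1)
proof (induction rule: rtrancl_induct)
  case (step v w)
  then obtain s where s: "fst s \<in> T" "v = step_tail G s" "w = step_head G s"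
    by (auto simp: adjacency_def)
  then have "f v = f w" using assms(2)[of "fst s"]
    by (auto simp: tension_def step_tail_def step_head_def)
  with step.IH show ?case by simp
qed simp

text \<open>
  The signed sum of the steps of a walk; it need not be simple, and no path has to be chosen.
\<close>

lemma integral_walk_vector:
  assumes "(u, v) \<in> (adjacency G T)\<^sup>*"
  shows "\<exists>w :: real ^ 'e::finite. (\<forall>e. w $ e \<in> \<int>) \<and> (\<forall>e. e \<notin> T \<longrightarrow> w $ e = 0) \<and>
      (\<forall>f. w \<bullet> tension G f = f v - f u)"
  using assms
proof (induction rule: rtrancl_induct)
  case base
  show ?case by (intro exI[of _ 0]) auto
next
  case (step v x)
  then obtain w :: "real ^ 'e" where w: "\<forall>e. w $ e \<in> \<int>" "\<forall>e. e \<notin> T \<longrightarrow> w $ e = 0"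
    "\<forall>f. w \<bullet> tension G f = f v - f u" by blast
  obtain s where s: "fst s \<in> T" "v = step_tail G s" "x = step_head G s"
    using step.hyps(2) by (auto simp: adjacency_def)
  have "(w + step_vector s) \<bullet> tension G f = f x - f u" for f
    using w(3) s by (simp add: inner_add_left step_vector_tension)
  moreover have "step_vector s $ e \<in> \<int>" "e \<notin> T \<Longrightarrow> step_vector s $ e = 0" for e
    using s(1) by (auto simp: step_vector_def axis_def)
  ultimately show ?case
    using w(1,2) by (intro exI[of _ "w + step_vector s"]) auto
qed

text \<open>
  When the walk is extended to the left by a vertex that it already visits, everything before that
  visit is dropped.
\<close>

lemma simple_path_exists:
  assumes "(u, v) \<in> (adjacency G T)\<^sup>*"
  obtains p where "fst ` set p \<subseteq> T" "u # map (step_head G) p = map (step_tail G) p @ [v]"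
    "distinct (map (step_tail G) p @ [v])"
proof -
  have "\<exists>p. fst ` set p \<subseteq> T \<and> u # map (step_head G) p = map (step_tail G) p @ [v] \<and>
      distinct (map (step_tail G) p @ [v])"
    using assms
  proof (induction rule: converse_rtrancl_induct)
    case base
    show ?case by (intro exI[of _ "[]"]) auto
  next
    case (step u w)
    then obtain p where p: "fst ` set p \<subseteq> T" "w # map (step_head G) p = map (step_tail G) p @ [v]"
      "distinct (map (step_tail G) p @ [v])" by blast
    obtain s where s: "fst s \<in> T" "u = step_tail G s" "w = step_head G s"
      using step.hyps(1) by (auto simp: adjacency_def)
    show ?case
    proof (cases "u \<in> set (map (step_tail G) p @ [v])")
      case False
      then show ?thesis using p s by (intro exI[of _ "s # p"]) auto
    next
      case True
      then obtain i where i: "i < length (map (step_tail G) p @ [v])" "(map (step_tail G) p @ [v]) ! i = u"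
        unfolding in_set_conv_nth by blast
      then have "i \<le> length p" by simp
      have "(w # map (step_head G) p) ! i = u" using i p(2) by simp
      then have "drop i (w # map (step_head G) p) = u # map (step_head G) (drop i p)"
        using \<open>i \<le> length p\<close> by (subst Cons_nth_drop_Suc[symmetric]) (auto simp: drop_map)
      moreover have "drop i (map (step_tail G) p @ [v]) = map (step_tail G) (drop i p) @ [v]"
        using \<open>i \<le> length p\<close> by (simp add: drop_map)
      moreover have "distinct (drop i (map (step_tail G) p @ [v]))" using p(3) by (rule distinct_drop)
      moreover have "fst ` set (drop i p) \<subseteq> T" using p(1) set_drop_subset[of i p] by blast
      ultimately show ?thesis using p(2) by (intro exI[of _ "drop i p"]) metis
    qed
  qed
  then show ?thesis using that by blast
qed

text \<open>
  Two traversals of one arc either start at the same vertex, or the first starts where the second ends.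
\<close>

lemma simple_path_distinct_arcs:
  assumes path: "u # map (step_head G) p = map (step_tail G) p @ [v]"
    and dist: "distinct (map (step_tail G) p @ [v])"
  shows "distinct (map fst p)"
proof -
  let ?x = "map (step_tail G) p @ [v]"
  have False if "i < j" "j < length p" "fst (p ! i) = fst (p ! j)" for i j
  proof -
    have tail: "step_tail G (p ! k) = ?x ! k" if "k < length p" for k
      using that by (simp add: nth_append)
    have head: "step_head G (p ! k) = ?x ! Suc k" if "k < length p" for k
      using that path[symmetric] by simp
    have "i < length p" using that by simp
    have "?x ! i = ?x ! j \<or> ?x ! i = ?x ! Suc j"
    proof (cases "snd (p ! i) = snd (p ! j)")
      case True
      then have "p ! i = p ! j" using that(3) by (simp add: prod_eq_iff)
      then show ?thesis using tail[OF \<open>i < length p\<close>] tail[OF that(2)] by metis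
    next
      case False
      then have "step_tail G (p ! i) = step_head G (p ! j)"
        using that(3) by (auto simp: step_tail_def step_head_def)
      then show ?thesis using tail[OF \<open>i < length p\<close>] head[OF that(2)] by metis
    qed
    moreover have "length ?x = Suc (length p)" by simp
    ultimately show False
      using that nth_eq_iff_index_eq[OF dist, of i j] nth_eq_iff_index_eq[OF dist, of i "Suc j"] by auto
  qed
  then show ?thesis
    unfolding distinct_conv_nth by (metis length_map linorder_neqE_nat nth_map)
qed

text \<open>
  If \<open>e\<close> carries flow, its end points remain connected in \<open>T - {e}\<close>; otherwise the tension of the
  component of one end point would have scalar product \<open>\<plusminus> z e\<close> with \<open>z\<close>.  A simple path between the end
  points closes up with \<open>e\<close> to a loop.
\<close>

lemma forest_circulation_zero:
  fixes G :: "('v, 'e::finite) pre_digraph"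
  assumes "\<not> (\<exists>S\<subseteq>T. is_loop G S)" "T \<subseteq> arcs G"
    and "z \<in> circulations G" "\<And>e. e \<notin> T \<Longrightarrow> z $ e = 0"
  shows "z = 0"
proof (rule ccontr)
  assume "z \<noteq> 0"
  then obtain e where e: "z $ e \<noteq> 0" by (auto simp: vec_eq_iff)
  then have "e \<in> T" using assms(4) by blast
  let ?X = "{v. (head G e, v) \<in> (adjacency G (T - {e}))\<^sup>*}"
  have "tail G e \<in> ?X"
  proof (rule ccontr)
    assume out: "tail G e \<notin> ?X"
    have "tension G (indicator ?X) $ a = 0" if "a \<in> T" "a \<noteq> e" for a
    proof -
      have "(tail G a, head G a) \<in> adjacency G (T - {e})" using that by (intro in_adjacency) auto
      moreover from this have "(head G a, tail G a) \<in> adjacency G (T - {e})"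
        using adjacency_sym by (rule symD[rotated])
      ultimately have "tail G a \<in> ?X \<longleftrightarrow> head G a \<in> ?X"
        by (auto intro: rtrancl_into_rtrancl)
      then show ?thesis by (simp add: tension_def indicator_def)
    qed
    then have "z $ a * tension G (indicator ?X) $ a = (if a = e then z $ e else 0)" for a
      using assms(4)[of a] out by (auto simp: tension_def)
    then have "z \<bullet> tension G (indicator ?X) = z $ e"
      by (simp add: inner_vec_def)
    then show False using assms(3) e by (simp add: circulations_def)
  qed
  then have "(head G e, tail G e) \<in> (adjacency G (T - {e}))\<^sup>*" by simp
  then obtain p where p: "fst ` set p \<subseteq> T - {e}"
    "head G e # map (step_head G) p = map (step_tail G) p @ [tail G e]"
    "distinct (map (step_tail G) p @ [tail G e])"
    by (rule simple_path_exists)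
  have "oriented_loop G ((e, True) # p)"
    using p simple_path_distinct_arcs[OF p(2,3)] assms(2) \<open>e \<in> T\<close>
    unfolding oriented_loop_def by (auto simp: step_tail_def[of G "(e, True)"] step_head_def[of G "(e, True)"])
  then have "is_loop G (fst ` set ((e, True) # p))" unfolding is_loop_def by blast
  moreover have "fst ` set ((e, True) # p) \<subseteq> T" using p(1) \<open>e \<in> T\<close> by auto
  ultimately show False using assms(1) by blast
qed

section \<open>The weighted tree formula for loop and cutset matrices\<close>

definition kirchhoff_matrix :: "'e set \<Rightarrow> real ^ 'e ^ 'e \<Rightarrow> real ^ 'e ^ 'e \<Rightarrow> real ^ 'e ^ 'e" where
  "kirchhoff_matrix K B Q = (\<chi> i. if i \<in> K then row i B else row i Q)"

lemma kirchhoff_loop_row: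
  assumes "reduced_loop_matrix G K B" "i \<in> K"
  shows "kirchhoff_matrix K B Q $ i \<in> circulations G"
proof -
  obtain p where "oriented_loop G p" "row i B = loop_row p"
    using assms by (auto simp: reduced_loop_matrix_def)
  then show ?thesis using loop_row_circulation assms(2) by (simp add: kirchhoff_matrix_def)
qed

lemma kirchhoff_cutset_row:
  assumes "reduced_cutset_matrix G (- K) Q" "i \<notin> K" "wf_digraph G" "arcs G = UNIV"
  shows "\<exists>f. kirchhoff_matrix K B Q $ i = tension G f"
proof -
  from assms have "i \<in> - K" by simp
  with assms(1) obtain S X where "X \<in> components (remove_arcs G S) - components G"
    "row i Q = cutset_row G S X"
    unfolding reduced_cutset_matrix_def by blast
  then have "row i Q = tension G (\<lambda>v. - indicator X v)"
    using cutset_row_eq_tension assms by fastforce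
  then show ?thesis using assms(2) by (auto simp: kirchhoff_matrix_def)
qed

lemma independent_rows_coeffs_zero:
  fixes A :: "real ^ 'e::finite ^ 'e"
  assumes "independent_rows K A" "(\<Sum>i\<in>K. y i *\<^sub>R row i A) = 0" "i \<in> K"
  shows "y i = 0"
proof (rule ccontr)
  assume "y i \<noteq> 0"
  let ?r = "\<lambda>i. row i A"
  let ?u = "\<lambda>w. y (inv_into K ?r w)"
  have inj: "inj_on ?r K" using assms(1) by (simp add: independent_rows_def)
  have inv: "inv_into K ?r (row j A) = j" if "j \<in> K" for j
    using inv_into_f_f[OF inj that] by simp
  have "(\<Sum>w\<in>?r ` K. ?u w *\<^sub>R w) = (\<Sum>i\<in>K. y i *\<^sub>R row i A)"
    using inj by (subst sum.reindex) (auto simp: inv intro!: sum.cong)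
  moreover have "?u (?r i) \<noteq> 0" using inv[OF assms(3)] \<open>y i \<noteq> 0\<close> by simp
  ultimately have "dependent (?r ` K)"
    using assms(2,3) by (subst dependent_finite) auto
  then show False using assms(1) by (simp add: independent_rows_def)
qed

text \<open>
  The loop rows are orthogonal to the cutset rows, so a linear relation among all rows splits into one
  among the loop rows and one among the cutset rows.
\<close>

lemma det_kirchhoff_matrix_nonzero:
  fixes G :: "('v, 'e::finite) pre_digraph"
  assumes "wf_digraph G" "arcs G = UNIV"
    and B: "reduced_loop_matrix G K B" and Q: "reduced_cutset_matrix G (- K) Q"
  shows "det (kirchhoff_matrix K B Q) \<noteq> 0"
proof -
  let ?S = "kirchhoff_matrix K B Q"
  have "y = 0" if y: "transpose ?S *v y = 0" for y
  proof -
    define b where "b = (\<Sum>i\<in>K. y $ i *\<^sub>R row i B)"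
    define q where "q = (\<Sum>i\<in>-K. y $ i *\<^sub>R row i Q)"
    have "transpose ?S *v y = (\<Sum>i\<in>UNIV. y $ i *\<^sub>R (?S $ i))"
      by (simp add: vec_eq_iff matrix_vector_mult_def transpose_def mult.commute)
    also have "\<dots> = (\<Sum>i\<in>K. y $ i *\<^sub>R (?S $ i)) + (\<Sum>i\<in>-K. y $ i *\<^sub>R (?S $ i))"
      by (subst sum.union_disjoint[symmetric]) auto
    also have "\<dots> = b + q"
      unfolding b_def q_def by (intro arg_cong2[where f = "(+)"] sum.cong) (auto simp: kirchhoff_matrix_def)
    finally have "b + q = 0" using y by simp
    have "row i B \<bullet> row j Q = 0" if ij: "i \<in> K" "j \<in> - K" for i j
    proof -
      obtain f where "?S $ j = tension G f"
        using kirchhoff_cutset_row[OF Q _ assms(1,2), of j] ij by blast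
      moreover have "?S $ i \<in> circulations G" using kirchhoff_loop_row[OF B ij(1)] .
      ultimately show ?thesis using ij by (simp add: kirchhoff_matrix_def circulations_def)
    qed
    then have "b \<bullet> q = 0"
      by (simp add: b_def q_def inner_sum_left inner_sum_right)
    with \<open>b + q = 0\<close> have "b = 0" "q = 0"
      by (auto simp: add_eq_0_iff)
    then have "y $ i = 0" for i
      using independent_rows_coeffs_zero[of K B "($) y" i] independent_rows_coeffs_zero[of "- K" Q "($) y" i] B Q
      by (cases "i \<in> K") (auto simp: b_def q_def reduced_loop_matrix_def reduced_cutset_matrix_def)
    then show ?thesis by (simp add: vec_eq_iff)
  qed
  then have "det (transpose ?S) \<noteq> 0" using det_nonzero_iff_ker by blast
  then show ?thesis by simp
qed

text \<open>
  Closing a walk inside \<open>T\<close> between the end points of a co-tree arc gives its fundamental cycle.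
\<close>

lemma spanning_tree_fundamental_basis:
  fixes G :: "('v, 'e::finite) pre_digraph"
  assumes "wf_digraph G" "arcs G = UNIV" and T: "is_spanning_tree G T"
  obtains c where "fundamental_basis (circulations G) T c"
proof -
  have conn: "(u, v) \<in> (adjacency G T)\<^sup>*" if "u \<in> verts G" "v \<in> verts G" for u v
    using T that connected_iff_adjacency[OF assms(1,2)] by (auto simp: is_spanning_tree_def)
  have "\<exists>z\<in>circulations G. (\<forall>b. b \<notin> T \<longrightarrow> z $ b = (if a = b then 1 else 0)) \<and> (\<forall>b. z $ b \<in> \<int>)"
    if "a \<notin> T" for a
  proof -
    have "head G a \<in> verts G" "tail G a \<in> verts G"
      using wf_digraph.head_in_verts[OF assms(1)] wf_digraph.tail_in_verts[OF assms(1)] assms(2) by auto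
    from integral_walk_vector[OF conn[OF this]] obtain w :: "real ^ 'e" where w: "\<forall>e. w $ e \<in> \<int>"
      "\<forall>e. e \<notin> T \<longrightarrow> w $ e = 0" "\<forall>f. w \<bullet> tension G f = f (tail G a) - f (head G a)"
      by blast
    have "axis a 1 + w \<in> circulations G"
      using w(3) by (simp add: circulations_def inner_add_left inner_axis' tension_def)
    moreover have "(axis a 1 + w) $ b = (if a = b then 1 else 0)" if "b \<notin> T" for b
      using w(2) that by (auto simp: axis_def)
    moreover have "(axis a 1 + w) $ b \<in> \<int>" for b
      using w(1) by (auto simp: axis_def)
    ultimately show ?thesis by blast
  qed
  then obtain c where "\<forall>a. a \<notin> T \<longrightarrow> c a \<in> circulations G \<and>
      (\<forall>b. b \<notin> T \<longrightarrow> c a $ b = (if a = b then 1 else 0)) \<and> (\<forall>b. c a $ b \<in> \<int>)"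
    by metis
  moreover have "\<forall>z\<in>circulations G. (\<forall>e. e \<notin> T \<longrightarrow> z $ e = 0) \<longrightarrow> z = 0"
    using forest_circulation_zero[of T G] T by (auto simp: is_spanning_tree_def)
  ultimately show ?thesis using that[of c] by (simp add: fundamental_basis_def)
qed

lemma tree_selection_circulation_ker:
  assumes "\<And>i. i \<notin> K \<Longrightarrow> S $ i \<bullet> z = 0" "\<And>e. e \<notin> T \<Longrightarrow> z $ e = 0"
  shows "tree_selection K T S *v z = 0"
proof -
  have "(tree_selection K T S *v z) $ i = (if i \<in> K then 0 else S $ i \<bullet> z)" for i
    using assms(2) by (auto simp: matrix_vector_mult_def tree_selection_def inner_vec_def
      intro!: sum.neutral sum.cong)
  then show ?thesis using assms(1) by (simp add: vec_eq_iff)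
qed

lemma tree_selection_cut_ker:
  assumes "\<And>i. i \<in> K \<Longrightarrow> S $ i \<bullet> z = 0" "\<And>e. e \<in> T \<Longrightarrow> z $ e = 0"
  shows "tree_selection K T S *v z = 0"
proof -
  have "(tree_selection K T S *v z) $ i = (if i \<in> K then S $ i \<bullet> z else 0)" for i
    using assms(2) by (auto simp: matrix_vector_mult_def tree_selection_def inner_vec_def
      intro!: sum.neutral sum.cong)
  then show ?thesis using assms(1) by (simp add: vec_eq_iff)
qed

text \<open>
  A loop inside \<open>T\<close>, and likewise a tension vanishing on \<open>T\<close>, is a kernel vector of the selected matrix:
  in each row it is paired either with entries where it vanishes or with a full row orthogonal to it.
\<close>

lemma spanning_tree_if_det_nonzero:
  fixes G :: "('v, 'e::finite) pre_digraph"
  assumes wf: "wf_digraph G" "arcs G = UNIV" and conn: "Digraph_Component.connected G"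
    and B: "reduced_loop_matrix G K B" and Q: "reduced_cutset_matrix G (- K) Q"
    and det: "det (tree_selection K T (kirchhoff_matrix K B Q)) \<noteq> 0"
  shows "is_spanning_tree G T"
proof -
  let ?S = "kirchhoff_matrix K B Q"
  have ker: "z = 0" if "tree_selection K T ?S *v z = 0" for z
    using det that det_nonzero_iff_ker by blast
  have no_loop: False if S: "S \<subseteq> T" "is_loop G S" for S
  proof -
    from S obtain p where p: "oriented_loop G p" "S = fst ` set p" by (auto simp: is_loop_def)
    have "(e, b) \<notin> set p" if "e \<notin> T" for e b
      using that S(1) p(2) image_eqI[of e fst "(e, b)" "set p"] by auto
    then have "loop_row p $ e = 0" if "e \<notin> T" for e
      using that by (simp add: loop_row_def)
    moreover have "?S $ i \<bullet> loop_row p = 0" if i: "i \<notin> K" for i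
    proof -
      obtain f where "?S $ i = tension G f"
        using kirchhoff_cutset_row[OF Q i wf] by blast
      then show ?thesis
        using loop_row_circulation[OF p(1)] by (simp add: circulations_def inner_commute)
    qed
    ultimately have zero: "loop_row p = 0" by (intro ker[OF tree_selection_circulation_ker])
    have "p \<noteq> []" using p(1) by (simp add: oriented_loop_def)
    then obtain e b where "(e, b) \<in> set p" by (cases p) auto
    then have "loop_row p $ e \<noteq> 0" by (cases b) (auto simp: loop_row_def)
    then show False using zero by simp
  qed
  have "G\<lparr>arcs := UNIV\<rparr> = G" unfolding wf(2)[symmetric] by simp
  then have verts: "verts G \<noteq> {}"
    and reach: "\<forall>u\<in>verts G. \<forall>v\<in>verts G. (u, v) \<in> (adjacency G UNIV)\<^sup>*"
    using conn connected_iff_adjacency[OF wf, of UNIV] by simp_all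
  have "(u, v) \<in> (adjacency G T)\<^sup>*" if uv: "u \<in> verts G" "v \<in> verts G" for u v
  proof -
    define X where "X = {v. (u, v) \<in> (adjacency G T)\<^sup>*}"
    let ?f = "indicator X :: 'v \<Rightarrow> real"
    have "tension G ?f $ a = 0" if "a \<in> T" for a
    proof -
      have "(tail G a, head G a) \<in> adjacency G T" using that by (rule in_adjacency)
      moreover from this have "(head G a, tail G a) \<in> adjacency G T"
        using adjacency_sym by (rule symD[rotated])
      ultimately have "tail G a \<in> X \<longleftrightarrow> head G a \<in> X"
        by (auto simp: X_def intro: rtrancl_into_rtrancl)
      then show ?thesis by (simp add: tension_def indicator_def)
    qed
    moreover have "?S $ i \<bullet> tension G ?f = 0" if "i \<in> K" for i
      using kirchhoff_loop_row[OF B that, of Q] by (simp add: circulations_def)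
    ultimately have "tension G ?f = 0" by (intro ker[OF tree_selection_cut_ker])
    then have "?f u = ?f v"
      by (intro tension_const_on_connected[OF reach[rule_format, OF uv]]) simp
    moreover have "u \<in> X" by (simp add: X_def)
    ultimately have "v \<in> X" by (simp add: indicator_def split: if_splits)
    then show ?thesis by (simp add: X_def)
  qed
  then have "verts G \<noteq> {} \<and> (\<forall>u\<in>verts G. \<forall>v\<in>verts G. (u, v) \<in> (adjacency G T)\<^sup>*)"
    by (intro conjI verts ballI)
  then have "Digraph_Component.connected (G\<lparr>arcs := T\<rparr>)"
    by (rule connected_iff_adjacency[OF wf, THEN iffD2])
  moreover have "\<not> (\<exists>S\<subseteq>T. is_loop G S)" by (auto dest: no_loop)
  moreover have "T \<subseteq> arcs G" unfolding wf(2) by (rule subset_UNIV)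
  ultimately show ?thesis unfolding is_spanning_tree_def by (intro conjI)
qed

text \<open>
  The selection along a spanning tree is the matrix of coefficients of the rows in the fundamental
  basis, and the determinant of that basis is the same for all spanning trees.
\<close>

theorem det_tree_selection:
  fixes G :: "('v, 'e::finite) pre_digraph"
  assumes wf: "wf_digraph G" "arcs G = UNIV" and conn: "Digraph_Component.connected G"
    and B: "reduced_loop_matrix G K B" and Q: "reduced_cutset_matrix G (- K) Q"
  shows "\<exists>k. k \<noteq> 0 \<and> (\<forall>T. det (tree_selection K T (kirchhoff_matrix K B Q)) =
    (if is_spanning_tree G T then k else 0))"
proof -
  let ?S = "kirchhoff_matrix K B Q"
  let ?d = "\<lambda>T. det (tree_selection K T ?S)"
  have prod: "?d T * det (fundamental_matrix T c) = det ?S"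
    if c: "fundamental_basis (circulations G) T c" for T c
  proof -
    have "tree_selection K T ?S ** fundamental_matrix T c = ?S"
    proof (rule tree_selection_mult_fundamental_matrix[OF subspace_circulations c])
      show "?S $ i \<in> circulations G" if "i \<in> K" for i by (rule kirchhoff_loop_row[OF B that])
      show "?S $ i \<bullet> z = 0" if iz: "i \<notin> K" "z \<in> circulations G" for i z
      proof -
        obtain f where "?S $ i = tension G f"
          using kirchhoff_cutset_row[OF Q iz(1) wf] by blast
        then show ?thesis using iz(2) by (simp add: circulations_def inner_commute)
      qed
    qed
    from arg_cong[OF this, of det] show ?thesis by (simp only: det_mul)
  qed
  have det_S: "det ?S \<noteq> 0" by (rule det_kirchhoff_matrix_nonzero[OF wf B Q])
  have nz: "?d T \<noteq> 0" and eq: "?d T = ?d T'" if T: "is_spanning_tree G T" and T': "is_spanning_tree G T'" for T T'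
  proof -
    obtain c where c: "fundamental_basis (circulations G) T c"
      by (rule spanning_tree_fundamental_basis[OF wf T])
    obtain c' where c': "fundamental_basis (circulations G) T' c'"
      by (rule spanning_tree_fundamental_basis[OF wf T'])
    show "?d T \<noteq> 0" using prod[OF c] det_S by auto
    have "?d T * det (fundamental_matrix T c) = ?d T' * det (fundamental_matrix T c)"
      using prod[OF c] prod[OF c'] det_fundamental_matrix_unique[OF subspace_circulations c c'] by simp
    then show "?d T = ?d T'" using det_fundamental_matrix_pos[of T c] by simp
  qed
  have nontree: "?d T = 0" if "\<not> is_spanning_tree G T" for T
    using spanning_tree_if_det_nonzero[OF wf conn B Q] that by blast
  show ?thesis
  proof (cases "\<exists>T. is_spanning_tree G T")
    case True
    then obtain T0 where T0: "is_spanning_tree G T0" by blast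
    show ?thesis
    proof (intro exI[of _ "?d T0"] conjI allI)
      show "?d T0 \<noteq> 0" by (rule nz[OF T0 T0])
      show "?d T = (if is_spanning_tree G T then ?d T0 else 0)" for T
        using eq[OF _ T0] nontree by simp
    qed
  next
    case False
    then show ?thesis using nontree by (intro exI[of _ 1]) auto
  qed
qed

corollary det_scaled_kirchhoff_matrix:
  fixes G :: "('v, 'e::finite) pre_digraph"
  assumes "wf_digraph G" "arcs G = UNIV" and "Digraph_Component.connected G"
    and "reduced_loop_matrix G K B" and "reduced_cutset_matrix G (- K) Q"
  shows "\<exists>k. k \<noteq> 0 \<and> (\<forall>b q.
    det (\<chi> i e. (if i \<in> K then b e else q e) * kirchhoff_matrix K B Q $ i $ e)
       = k * (\<Sum>T | is_spanning_tree G T. (\<Prod>e\<in>T. q e) * (\<Prod>e\<in>-T. b e)))"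
proof -
  let ?S = "kirchhoff_matrix K B Q"
  obtain k where k: "k \<noteq> 0"
    "\<forall>T. det (tree_selection K T ?S) = (if is_spanning_tree G T then k else 0)"
    using det_tree_selection[OF assms] by blast
  have "det (\<chi> i e. (if i \<in> K then b e else q e) * ?S $ i $ e)
      = k * (\<Sum>T | is_spanning_tree G T. (\<Prod>e\<in>T. q e) * (\<Prod>e\<in>-T. b e))" for b q
  proof -
    let ?w = "\<lambda>T. (\<Prod>e\<in>T. q e) * (\<Prod>e\<in>-T. b e)"
    have "det (\<chi> i e. (if i \<in> K then b e else q e) * ?S $ i $ e)
        = (\<Sum>T\<in>UNIV. if is_spanning_tree G T then k * ?w T else 0)"
      unfolding det_block_scaling using k(2) by (intro sum.cong) auto
    also have "\<dots> = k * (\<Sum>T | is_spanning_tree G T. ?w T)"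
      by (simp add: sum.If_cases sum_distrib_left)
    finally show ?thesis .
  qed
  with k(1) show ?thesis by blast
qed

text \<open>
  \<open>P\<close> is the set of branches that a tree must contain, \<open>N\<close> the set of branches that it must avoid.
\<close>

lemma tree_weight:
  fixes T :: "'e::finite set"
  assumes "P \<inter> N = {}"
  shows "(\<Prod>e\<in>T. if e \<in> N then 0 else 1) * (\<Prod>e\<in>-T. if e \<in> P then 0 else if e \<in> N then 1 else r e)
    = (if P \<subseteq> T \<and> N \<inter> T = {} then \<Prod>e\<in>-(T \<union> N). r e else (0::real))"
proof (cases "P \<subseteq> T \<and> N \<inter> T = {}")
  case True
  have "(\<Prod>e\<in>T. if e \<in> N then 0 else (1 :: real)) = (\<Prod>e\<in>T. 1)"
    using True by (intro prod.cong) auto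
  moreover have "(\<Prod>e\<in>-T. if e \<in> P then 0 else if e \<in> N then 1 else r e)
      = (\<Prod>e\<in>-(T \<union> N). r e)"
    using True by (intro prod.mono_neutral_cong_right) auto
  ultimately show ?thesis using True by simp
next
  case False
  then consider e where "e \<in> T" "e \<in> N" | e where "e \<in> - T" "e \<in> P" by blast
  then have "(\<Prod>e\<in>T. if e \<in> N then 0 else (1 :: real)) = 0 \<or>
      (\<Prod>e\<in>-T. if e \<in> P then 0 else if e \<in> N then 1 else r e) = 0"
    by cases (auto intro: prod_zero)
  then show ?thesis using False by auto
qed

section \<open>Zero as a root of the pencil polynomial\<close>

definition y_part :: "real ^ ('d::finite + 'e::finite) \<Rightarrow> real ^ 'd" where
  "y_part w = (\<chi> d. w $ Inl d)"

lemma y_part_stack [simp]: "y_part (stack y z) = y"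
  by (simp add: y_part_def stack_def vec_eq_iff)

lemma z_at_stack [simp]: "z_at (stack y z) = z"
  by (simp add: z_at_def stack_def vec_eq_iff)

lemma stack_y_part_z_at: "stack (y_part w) (z_at w) = w"
proof -
  have "stack (y_part w) (z_at w) $ i = w $ i" for i
    by (cases i) (auto simp: stack_def y_part_def z_at_def)
  then show ?thesis by (simp add: vec_eq_iff)
qed

lemma linear_y_part: "linear y_part"
  by (rule linearI) (auto simp: y_part_def vec_eq_iff)

lemma linear_z_at: "linear z_at"
  by (rule linearI) (auto simp: z_at_def vec_eq_iff)

lemma stack_add: "stack (y + y') (z + z') = stack y z + stack y' z'"
  by (auto simp: stack_def vec_eq_iff split: sum.split)

lemma stack_scaleR: "stack (c *\<^sub>R y) (c *\<^sub>R z) = c *\<^sub>R stack y z"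
  by (auto simp: stack_def vec_eq_iff split: sum.split)

lemma linear_stack:
  assumes "linear f" "linear g"
  shows "linear (\<lambda>v. stack (f v) (g v))"
  using assms by (intro linearI) (simp_all add: linear_add linear_scale stack_add stack_scaleR)

lemma poly_pencil_poly:
  "poly (pencil_poly A) t = det (\<chi> i j. (if i = j \<and> isl i then t else 0) - A $ i $ j)"
  unfolding pencil_poly_def det_def poly_sum poly_mult poly_prod poly_of_int vec_lambda_beta
  by (intro sum.cong arg_cong2[where f = "(*)"] prod.cong refl) auto

lemma pencil_mult:
  fixes A :: "real ^ ('d::finite + 'e::finite) ^ ('d + 'e)"
  shows "(\<chi> i j. (if i = j \<and> isl i then t else 0) - A $ i $ j) *v w = stack (t *\<^sub>R y_part w) 0 - A *v w"
proof -
  have "((\<chi> i j. (if i = j \<and> isl i then t else 0) - A $ i $ j) *v w) $ i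
      = stack (t *\<^sub>R y_part w) 0 $ i - (A *v w) $ i" for i
  proof -
    have "((\<chi> i j. (if i = j \<and> isl i then t else 0) - A $ i $ j) *v w) $ i
      = (\<Sum>j\<in>UNIV. (if i = j then (if isl i then t else 0) * w $ j else 0) - A $ i $ j * w $ j)"
      by (auto simp: matrix_vector_mult_def algebra_simps intro!: sum.cong)
    also have "\<dots> = (if isl i then t else 0) * w $ i - (A *v w) $ i"
      by (simp add: sum_subtractf matrix_vector_mult_def)
    finally show ?thesis by (cases i) (auto simp: stack_def y_part_def)
  qed
  then show ?thesis by (simp add: vec_eq_iff)
qed

lemma poly_pencil_poly_eq_0_iff:
  "poly (pencil_poly A) t = 0 \<longleftrightarrow> (\<exists>w. w \<noteq> 0 \<and> A *v w = stack (t *\<^sub>R y_part w) 0)"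
  unfolding poly_pencil_poly using det_nonzero_iff_ker[of "\<chi> i j. (if i = j \<and> isl i then t else 0) - A $ i $ j"]
  by (auto simp: pencil_mult)

text \<open>
  If the algebraic equations can be solved for \<open>z\<close>, the pencil reduces to an ordinary eigenvalue
  problem for \<open>y\<close>, whose eigenvalues are bounded by the operator norm.
\<close>

lemma pencil_poly_nonzero:
  fixes A :: "real ^ ('d::finite + 'e::finite) ^ ('d + 'e)"
  assumes "\<And>z. z_at (A *v stack 0 z) = 0 \<Longrightarrow> z = 0"
  shows "pencil_poly A \<noteq> 0"
proof
  assume zero: "pencil_poly A = 0"
  let ?f = "\<lambda>z. z_at (A *v stack 0 z)"
  have lin: "linear (\<lambda>v. z_at (A *v stack (f v) (g v)))" "linear (\<lambda>v. y_part (A *v stack (f v) (g v)))"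
    if "linear f" "linear g" for f :: "'x::real_vector \<Rightarrow> real ^ 'd" and g :: "'x \<Rightarrow> real ^ 'e"
    using linear_compose[OF linear_compose[OF linear_stack[OF that] matrix_vector_mul_linear[of A]] linear_z_at]
      linear_compose[OF linear_compose[OF linear_stack[OF that] matrix_vector_mul_linear[of A]] linear_y_part]
    by (simp_all add: o_def)
  have f: "linear ?f" by (intro lin linear_zero linear_ident)
  then have "inj ?f" using assms by (simp add: linear_injective_0)
  then obtain g where g: "linear g" "g \<circ> ?f = id"
    using linear_injective_left_inverse[OF f] by blast
  define z where "z y = - g (z_at (A *v stack y 0))" for y
  have "linear (\<lambda>y. z_at (A *v stack y 0))" by (intro lin linear_zero linear_ident)
  then have "linear z"
    unfolding z_def using linear_compose[OF _ g(1)] linear_compose_neg by (fastforce simp: o_def)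
  define \<Phi> where "\<Phi> y = y_part (A *v stack y (z y))" for y
  have "linear \<Phi>" unfolding \<Phi>_def by (intro lin linear_ident \<open>linear z\<close>)
  then have bl: "bounded_linear \<Phi>" by (simp add: linear_conv_bounded_linear)
  \<comment> \<open>Beyond the operator norm of the reduced system there is no eigenvalue.\<close>
  define t where "t = onorm \<Phi> + 1"
  have "t > onorm \<Phi>" "t \<ge> 0" using onorm_pos_le[OF bl] by (auto simp: t_def)
  obtain w where w: "w \<noteq> 0" "A *v w = stack (t *\<^sub>R y_part w) 0"
    using zero poly_pencil_poly_eq_0_iff[of A t] by auto
  let ?y = "y_part w"
  have "A *v w = A *v stack ?y 0 + A *v stack 0 (z_at w)"
    using stack_add[of ?y 0 0 "z_at w"] by (simp add: stack_y_part_z_at flip: matrix_vector_right_distrib)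
  then have "0 = z_at (A *v stack ?y 0) + ?f (z_at w)"
    using w(2) linear_add[OF linear_z_at] by (metis z_at_stack)
  then have "?f (z_at w) = - z_at (A *v stack ?y 0)" by (simp add: eq_neg_iff_add_eq_0 add.commute)
  then have "g (?f (z_at w)) = z ?y" by (simp add: z_def linear_neg[OF g(1)])
  then have z: "z_at w = z ?y" using g(2) by (metis comp_apply id_apply)
  have "\<Phi> ?y = t *\<^sub>R ?y"
    using w(2) by (simp add: \<Phi>_def flip: z) (simp add: stack_y_part_z_at)
  then have "t * norm ?y \<le> onorm \<Phi> * norm ?y"
    using onorm[OF bl, of ?y] \<open>t \<ge> 0\<close> by simp
  then have "?y = 0" using \<open>t > onorm \<Phi>\<close> by (simp add: mult_le_cancel_right)
  moreover have "z 0 = 0" using \<open>linear z\<close> by (rule linear_0)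
  ultimately have "w = stack 0 0" using z stack_y_part_z_at[of w] by simp
  also have "\<dots> = 0" using stack_scaleR[of 0 0 0] by simp
  finally show False using w(1) by simp
qed

text \<open>
  The column of the variable \<open>m\<close> contains only \<open>\<lambda>\<close> on the diagonal, which can be pulled out of the
  determinant.  What remains still vanishes at zero, because \<open>w\<close> is in the kernel.  Depending on whether
  its entry at \<open>m\<close> vanishes, \<open>w\<close> is a second eigenvector or the second vector of a Jordan chain; the
  equation covers both cases.
\<close>

lemma pencil_poly_double_zero:
  fixes A :: "real ^ ('d::finite + 'e::finite) ^ ('d + 'e)"
  assumes col: "A *v axis (Inl m) 1 = 0"
    and chain: "A *v w = axis (Inl m) (w $ Inl m)" "w \<noteq> 0"
    and nz: "pencil_poly A \<noteq> 0"
  shows "order 0 (pencil_poly A) > 1"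
proof -
  define P where "P = (\<chi> i j. [: - (A $ i $ j), (if i = j \<and> isl i then 1 else 0) :])"
  define P' where "P' = (\<chi> j. if j = Inl m then axis (Inl m) 1 else transpose P $ j)"
  have A_col: "A $ i $ Inl m = 0" for i
    using arg_cong[OF col, of "\<lambda>v. v $ i"] by (simp add: matrix_vector_mult_def axis_def if_distrib cong: if_cong)
  have "transpose P = (\<chi> j. if j = Inl m then [:0, 1:] *s axis (Inl m) 1 else transpose P $ j)"
    by (auto simp: vec_eq_iff P_def transpose_def axis_def A_col)
  from arg_cong[OF this, of det] have "det (transpose P) = [:0, 1:] * det P'"
    unfolding P'_def by (rule trans) (rule det_row_mul)
  then have factor: "pencil_poly A = [:0, 1:] * det P'"
    by (simp add: pencil_poly_def P_def)
  have "poly (det P') 0 = det (transpose (\<chi> i j. poly (P' $ j $ i) 0))"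
    by (simp add: det_def poly_sum poly_prod transpose_def)
  also have "\<dots> = 0"
  proof -
    have "((\<chi> i j. poly (P' $ j $ i) 0) *v w) $ i = 0" for i
    proof -
      have "((\<chi> i j. poly (P' $ j $ i) 0) *v w) $ i
          = (\<Sum>j\<in>UNIV. (if j = Inl m then axis (Inl m) (w $ Inl m) $ i else 0) - A $ i $ j * w $ j)"
        unfolding matrix_vector_mult_def
        by (auto simp: P'_def P_def transpose_def axis_def A_col intro!: sum.cong)
      also have "\<dots> = axis (Inl m) (w $ Inl m) $ i - (A *v w) $ i"
        by (simp add: sum_subtractf matrix_vector_mult_def)
      finally show ?thesis by (simp add: chain(1))
    qed
    then have "(\<chi> i j. poly (P' $ j $ i) 0) *v w = 0" by (simp add: vec_eq_iff)
    then have "det (\<chi> i j. poly (P' $ j $ i) 0) = 0" using chain(2) det_nonzero_iff_ker by blast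
    then show ?thesis by (simp only: det_transpose)
  qed
  finally have "[:0, 1:] dvd det P'" using poly_eq_0_iff_dvd[of "det P'" 0] by simp
  then have "[:0, 1:] ^ 2 dvd pencil_poly A" 
    unfolding factor power2_eq_square by (rule mult_dvd_mono[OF dvd_refl])
  then show ?thesis using order_divides[of 0 2 "pencil_poly A"] nz by simp
qed

section \<open>Linearisation at an equilibrium\<close>

text \<open>
  The product rule where one factor vanishes: for the other factor continuity is enough.  It
  applies to the inverses of the capacitance and inductance matrices, which are merely continuous and
  multiply quantities that vanish at the equilibrium.
\<close>

lemma has_derivative_vanishing_factor:
  fixes f l :: "'a::real_normed_vector \<Rightarrow> real"
  assumes "isCont f a" "bounded_linear l" "l a = 0"
  shows "((\<lambda>x. f x * l x) has_derivative (\<lambda>v. f a * l v)) (at a)"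
  unfolding has_derivative_at
proof
  show "bounded_linear (\<lambda>v. f a * l v)" using assms(2) by (rule bounded_linear_const_mult)
  obtain k where k: "k > 0" "\<And>v. norm (l v) \<le> norm v * k"
    using bounded_linear.pos_bounded[OF assms(2)] by blast
  have shift: "l (a + v) = l v" for v
    using assms(3) linear_add[OF bounded_linear.linear[OF assms(2)], of a v] by simp
  have "(\<lambda>v. f (a + v)) \<midarrow>0\<rightarrow> f a" using assms(1) by (simp add: isCont_def LIM_offset_zero)
  then have "(\<lambda>v. \<bar>f (a + v) - f a\<bar> * k) \<midarrow>0\<rightarrow> \<bar>f a - f a\<bar> * k" by (intro tendsto_intros)
  then have lim: "(\<lambda>v. \<bar>f (a + v) - f a\<bar> * k) \<midarrow>0\<rightarrow> 0" by simp
  have bound: "norm (norm (f (a + v) * l (a + v) - f a * l a - f a * l v) / norm v)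
      \<le> \<bar>f (a + v) - f a\<bar> * k" for v
  proof -
    have "f (a + v) * l (a + v) - f a * l a - f a * l v = (f (a + v) - f a) * l v"
      by (simp add: shift assms(3) algebra_simps)
    then have "norm (f (a + v) * l (a + v) - f a * l a - f a * l v) \<le> \<bar>f (a + v) - f a\<bar> * (norm v * k)"
      using k(2)[of v] by (simp add: abs_mult mult_left_mono)
    then show ?thesis by (cases "v = 0") (auto simp: divide_le_eq mult_ac k(1) less_imp_le)
  qed
  show "(\<lambda>v. norm (f (a + v) * l (a + v) - f a * l a - f a * l v) / norm v) \<midarrow>0\<rightarrow> 0"
    by (rule Lim_null_comparison[OF always_eventually[OF allI[OF bound]] lim])
qed

lemma isCont_det:
  fixes A :: "'a::t2_space \<Rightarrow> real ^ 'n::finite ^ 'n"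
  assumes "\<And>i j. isCont (\<lambda>x. A x $ i $ j) a"
  shows "isCont (\<lambda>x. det (A x)) a"
  unfolding det_def isCont_def
  by (intro tendsto_sum tendsto_mult tendsto_const tendsto_prod assms[unfolded isCont_def])

lemma matrix_inv_right:
  fixes A :: "real ^ 'n::finite ^ 'n"
  assumes "invertible A"
  shows "A ** matrix_inv A = mat 1"
  using someI_ex[OF assms[unfolded invertible_def]] unfolding matrix_inv_def by (rule conjunct1)

text \<open>
  Cramer's rule exhibits the entries of the inverse as quotients of determinants.
\<close>

lemma isCont_matrix_inv:
  fixes A :: "'a::t2_space \<Rightarrow> real ^ 'n::finite ^ 'n"
  assumes A: "\<And>i j. isCont (\<lambda>x. A x $ i $ j) a" and inv: "invertible (A a)"
  shows "isCont (\<lambda>x. matrix_inv (A x) $ k $ j) a"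
proof -
  let ?N = "\<lambda>x. \<chi> i l. if l = k then axis j 1 $ i else A x $ i $ l"
  have det: "isCont (\<lambda>x. det (A x)) a" using A by (rule isCont_det)
  have nz: "det (A a) \<noteq> 0" using inv by (simp add: invertible_det_nz)
  have cramer_entry: "matrix_inv (A x) $ k $ j = det (?N x) / det (A x)" if "det (A x) \<noteq> 0" for x
  proof -
    have "A x *v (matrix_inv (A x) *v axis j 1) = axis j 1"
      using that by (simp add: matrix_vector_mul_assoc matrix_inv_right invertible_det_nz)
    then have "matrix_inv (A x) *v axis j 1 = (\<chi> k. det (\<chi> i l. if l = k then axis j 1 $ i else A x $ i $ l) / det (A x))"
      using cramer[OF that] by blast
    then have "(matrix_inv (A x) *v axis j 1) $ k = det (?N x) / det (A x)" by simp
    then show ?thesis by (simp add: matrix_vector_mult_basis column_def)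
  qed
  have "\<forall>\<^sub>F x in nhds a. det (A x) \<noteq> 0"
    using tendsto_imp_eventually_ne[OF det[unfolded isCont_def] nz] nz by (simp add: eventually_nhds_conv_at)
  then have "\<forall>\<^sub>F x in nhds a. matrix_inv (A x) $ k $ j = det (?N x) / det (A x)"
    by eventually_elim (rule cramer_entry)
  then have cong: "isCont (\<lambda>x. matrix_inv (A x) $ k $ j) a \<longleftrightarrow> isCont (\<lambda>x. det (?N x) / det (A x)) a"
    by (rule isCont_cong)
  have "isCont (\<lambda>x. det (?N x)) a"
  proof (rule isCont_det)
    show "isCont (\<lambda>x. ?N x $ i $ l) a" for i l using A by (cases "l = k") auto
  qed
  then show ?thesis unfolding cong using det nz by (rule isCont_divide)
qed

lemma has_derivative_matrix_inv_vanishing: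
  fixes A :: "'a::real_normed_vector \<Rightarrow> real ^ 'n::finite ^ 'n" and w :: "'a \<Rightarrow> real ^ 'n"
  assumes "\<And>i j. isCont (\<lambda>x. A x $ i $ j) a" "invertible (A a)" "bounded_linear w" "w a = 0"
  shows "((\<lambda>x. (matrix_inv (A x) *v w x) $ k) has_derivative (\<lambda>v. (matrix_inv (A a) *v w v) $ k)) (at a)"
proof -
  have "bounded_linear (\<lambda>x. w x $ j)" for j
    using bounded_linear_compose[OF bounded_linear_vec_nth assms(3)] .
  then have "((\<lambda>x. matrix_inv (A x) $ k $ j * w x $ j) has_derivative
      (\<lambda>v. matrix_inv (A a) $ k $ j * w v $ j)) (at a)" for j
    by (rule has_derivative_vanishing_factor[OF isCont_matrix_inv[OF assms(1,2)]]) (simp add: assms(4))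
  then show ?thesis unfolding matrix_vector_mult_def vec_lambda_beta by (rule has_derivative_sum)
qed

lemma has_derivative_vec_componentwise:
  fixes f :: "'a::real_normed_vector \<Rightarrow> real ^ 'n::finite"
  assumes "\<And>i. ((\<lambda>x. f x $ i) has_derivative (\<lambda>v. f' v $ i)) (at a)"
  shows "(f has_derivative f') (at a)"
  using assms by (subst has_derivative_componentwise_within) (auto simp: Basis_vec_def inner_axis)

text \<open>
  The linearisation of a circuit is the circuit of the linearised devices, with all sources set to zero.
\<close>

definition linearised_circuit ::
  "('e \<Rightarrow> device) \<Rightarrow> ('d \<Rightarrow> 'e) \<Rightarrow> 'e set \<Rightarrow> real ^ 'e ^ 'e \<Rightarrow> real ^ 'e ^ 'e \<Rightarrow>
   real ^ 'e ^ 'e \<Rightarrow> real ^ 'e ^ 'e \<Rightarrow> real \<Rightarrow> real ^ 'e ^ 'e \<Rightarrow>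
   real ^ ('d::finite + 'e::finite) \<Rightarrow> real ^ ('d + 'e)" where
  "linearised_circuit kind dyn K B Q C L m R v =
     stack (h_map kind dyn (\<lambda>_. C) (\<lambda>_. L) v) (g_map kind dyn K B Q (\<lambda>_. m) (\<lambda>i. R *v i) 0 0 v)"

lemma linear_y_at: "linear (y_at dyn)"
  by (rule linearI) (auto simp: y_at_def vec_eq_iff)

lemma linear_on_class: "linear (on_class kind k)"
  by (rule linearI) (auto simp: on_class_def vec_eq_iff)

lemma bounded_linear_on_class_z_at: "bounded_linear (\<lambda>x. on_class kind k (z_at x))"
  using linear_compose[OF linear_z_at linear_on_class] by (simp add: o_def linear_conv_bounded_linear)

lemma bounded_linear_on_class_y_at: "bounded_linear (\<lambda>x. on_class kind k (y_at dyn x))"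
  using linear_compose[OF linear_y_at linear_on_class] by (simp add: o_def linear_conv_bounded_linear)

lemma bounded_linear_entry: "bounded_linear (\<lambda>x. z_at x $ e)" "bounded_linear (\<lambda>x. y_at dyn x $ e)"
  using bounded_linear_compose[OF bounded_linear_vec_nth] linear_z_at linear_y_at
  by (auto simp: linear_conv_bounded_linear)

lemma isCont_class_block:
  assumes "isCont D a"
  shows "isCont (\<lambda>x. class_block kind k (D x) $ i $ j) a"
  using assms by (cases "kind i = k \<and> kind j = k") (auto simp: class_block_def)

text \<open>
  The matrix extended by an identity block acts as the identity outside the class; hence the
  product vanishes there, too.
\<close>

lemma on_class_zero_if_inverse_zero:
  fixes w :: "real ^ 'e::finite"
  assumes inv: "invertible (class_block kind k D)"
    and zero: "\<And>e. kind e = k \<Longrightarrow> (matrix_inv (class_block kind k D) *v on_class kind k w) $ e = 0"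
  shows "on_class kind k w = 0"
proof -
  let ?A = "class_block kind k D"
  let ?u = "matrix_inv ?A *v on_class kind k w"
  have Au: "?A *v ?u = on_class kind k w"
    by (simp add: matrix_vector_mul_assoc matrix_inv_right[OF inv])
  have "?u $ e = 0" for e
  proof (cases "kind e = k")
    case False
    have "(?A *v u) $ e = u $ e" for u
    proof -
      have "?A $ e $ j * u $ j = (if e = j then u $ j else 0)" for j
        using False by (simp add: class_block_def)
      then show ?thesis by (simp add: matrix_vector_mult_def)
    qed
    from this[of ?u] have "?u $ e = on_class kind k w $ e" unfolding Au by (rule sym)
    then show ?thesis using False by (simp add: on_class_def)
  qed (rule zero)
  then have "?u = 0" by (simp add: vec_eq_iff)
  then show ?thesis using Au by simp
qed

lemma enumerates_dynamic_surj:
  assumes "enumerates_dynamic dyn kind" "kind e \<in> {Memristor, Capacitor, Inductor}"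
  shows "\<exists>d. dyn d = e"
proof -
  have "e \<in> range dyn"
    using bij_betw_imp_surj_on[OF assms(1)[unfolded enumerates_dynamic_def]] assms(2) by auto
  then show ?thesis by auto
qed

lemma equilibrium_memristor_current:
  assumes "enumerates_dynamic dyn kind" "h_map kind dyn C L x = 0" "kind e = Memristor"
  shows "z_at x $ e = 0"
proof -
  obtain d where d: "dyn d = e" using enumerates_dynamic_surj[OF assms(1), of e] assms(3) by auto
  have "h_map kind dyn C L x $ d = 0" using assms(2) by simp
  then show ?thesis using d assms(3) by (simp add: h_map_def)
qed

lemma equilibrium_capacitor_currents:
  assumes dyn: "enumerates_dynamic dyn kind" and h: "h_map kind dyn C L x = 0"
    and inv: "invertible (class_block kind Capacitor (C (cap_voltages kind dyn x)))"
  shows "on_class kind Capacitor (z_at x) = 0"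
proof (rule on_class_zero_if_inverse_zero[OF inv])
  fix e assume e: "kind e = Capacitor"
  then obtain d where d: "dyn d = e" using enumerates_dynamic_surj[OF dyn, of e] by auto
  have "h_map kind dyn C L x $ d = 0" using h by simp
  then show "(matrix_inv (class_block kind Capacitor (C (cap_voltages kind dyn x)))
      *v on_class kind Capacitor (z_at x)) $ e = 0" using d e by (simp add: h_map_def)
qed

lemma equilibrium_inductor_voltages:
  assumes dyn: "enumerates_dynamic dyn kind" and h: "h_map kind dyn C L x = 0"
    and inv: "invertible (class_block kind Inductor (L (ind_currents kind dyn x)))"
  shows "on_class kind Inductor (z_at x) = 0"
proof (rule on_class_zero_if_inverse_zero[OF inv])
  fix e assume e: "kind e = Inductor"
  then obtain d where d: "dyn d = e" using enumerates_dynamic_surj[OF dyn, of e] by auto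
  have "h_map kind dyn C L x $ d = 0" using h by simp
  then show "(matrix_inv (class_block kind Inductor (L (ind_currents kind dyn x)))
      *v on_class kind Inductor (z_at x)) $ e = 0" using d e by (simp add: h_map_def)
qed

lemma has_derivative_h_map:
  fixes x :: "real ^ ('d::finite + 'e::finite)"
  assumes C: "isCont C (cap_voltages kind dyn x)" "invertible (class_block kind Capacitor (C (cap_voltages kind dyn x)))"
    and L: "isCont L (ind_currents kind dyn x)" "invertible (class_block kind Inductor (L (ind_currents kind dyn x)))"
    and zero: "on_class kind Capacitor (z_at x) = 0" "on_class kind Inductor (z_at x) = 0"
  shows "((\<lambda>x. h_map kind dyn C L x $ d) has_derivative
    (\<lambda>v. h_map kind dyn (\<lambda>_. C (cap_voltages kind dyn x)) (\<lambda>_. L (ind_currents kind dyn x)) v $ d)) (at x)"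
proof -
  have "isCont (cap_voltages kind dyn) x" "isCont (ind_currents kind dyn) x"
    unfolding cap_voltages_def[abs_def] ind_currents_def[abs_def]
    by (intro linear_continuous_at bounded_linear_on_class_y_at)+
  then have cont: "isCont (\<lambda>x. C (cap_voltages kind dyn x)) x" "isCont (\<lambda>x. L (ind_currents kind dyn x)) x"
    using C(1) L(1) by (auto intro: isCont_o2)
  have "((\<lambda>x. (matrix_inv (class_block kind Capacitor (C (cap_voltages kind dyn x))) *v on_class kind Capacitor (z_at x)) $ e)
      has_derivative (\<lambda>v. (matrix_inv (class_block kind Capacitor (C (cap_voltages kind dyn x))) *v on_class kind Capacitor (z_at v)) $ e)) (at x)"
    and "((\<lambda>x. (matrix_inv (class_block kind Inductor (L (ind_currents kind dyn x))) *v on_class kind Inductor (z_at x)) $ e)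
      has_derivative (\<lambda>v. (matrix_inv (class_block kind Inductor (L (ind_currents kind dyn x))) *v on_class kind Inductor (z_at v)) $ e)) (at x)" for e
    by (intro has_derivative_matrix_inv_vanishing isCont_class_block cont C(2) L(2) zero bounded_linear_on_class_z_at)+
  moreover have "((\<lambda>x. z_at x $ e) has_derivative (\<lambda>v. z_at v $ e)) (at x)" for e
    by (rule bounded_linear_imp_has_derivative[OF bounded_linear_entry(1)])
  ultimately show ?thesis
    by (cases "kind (dyn d)") (simp_all add: h_map_def)
qed

lemma has_derivative_branch_voltages:
  fixes x :: "real ^ ('d::finite + 'e::finite)"
  assumes M: "isCont M (charge kind dyn x)"
    and \<gamma>: "(\<gamma> has_derivative (\<lambda>u. R *v u)) (at (res_currents kind x))"
    and zero: "\<And>e. kind e = Memristor \<Longrightarrow> z_at x $ e = 0"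
  shows "((\<lambda>x. branch_voltages kind dyn M \<gamma> V x $ e) has_derivative
    (\<lambda>v. branch_voltages kind dyn (\<lambda>_. M (charge kind dyn x)) (\<lambda>i. R *v i) 0 v $ e)) (at x)"
proof -
  have entry: "((\<lambda>x. z_at x $ e) has_derivative (\<lambda>v. z_at v $ e)) (at x)"
    "((\<lambda>x. y_at dyn x $ e) has_derivative (\<lambda>v. y_at dyn v $ e)) (at x)"
    by (rule bounded_linear_imp_has_derivative[OF bounded_linear_entry(1)],
        rule bounded_linear_imp_has_derivative[OF bounded_linear_entry(2)])
  have "isCont (charge kind dyn) x"
    unfolding charge_def[abs_def] by (rule linear_continuous_at[OF bounded_linear_entry(2)])
  then have "isCont (\<lambda>x. M (charge kind dyn x)) x" using M by (rule isCont_o2)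
  then have mem: "((\<lambda>x. M (charge kind dyn x) * z_at x $ e) has_derivative
      (\<lambda>v. M (charge kind dyn x) * z_at v $ e)) (at x)" if "kind e = Memristor"
    using zero[OF that] by (intro has_derivative_vanishing_factor bounded_linear_entry(1))
  have "(res_currents kind has_derivative res_currents kind) (at x)"
    unfolding res_currents_def[abs_def]
    by (rule bounded_linear_imp_has_derivative[OF bounded_linear_on_class_z_at])
  from has_derivative_compose[OF this \<gamma>]
  have "((\<lambda>x. \<gamma> (res_currents kind x)) has_derivative (\<lambda>v. R *v res_currents kind v)) (at x)" .
  then have res: "((\<lambda>x. \<gamma> (res_currents kind x) $ e) has_derivative (\<lambda>v. (R *v res_currents kind v) $ e)) (at x)"
    by (rule bounded_linear.has_derivative[OF bounded_linear_vec_nth])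
  show ?thesis
    using entry mem res by (cases "kind e") (simp_all add: branch_voltages_def)
qed

lemma has_derivative_branch_currents:
  fixes x :: "real ^ ('d::finite + 'e::finite)"
  shows "((\<lambda>x. branch_currents kind dyn I x $ e) has_derivative (\<lambda>v. branch_currents kind dyn 0 v $ e)) (at x)"
proof -
  have "((\<lambda>x. z_at x $ e) has_derivative (\<lambda>v. z_at v $ e)) (at x)"
    "((\<lambda>x. y_at dyn x $ e) has_derivative (\<lambda>v. y_at dyn v $ e)) (at x)"
    by (rule bounded_linear_imp_has_derivative[OF bounded_linear_entry(1)],
        rule bounded_linear_imp_has_derivative[OF bounded_linear_entry(2)])
  then show ?thesis by (cases "kind e") (simp_all add: branch_currents_def)
qed

lemma has_derivative_g_map:
  fixes x :: "real ^ ('d::finite + 'e::finite)"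
  assumes "isCont M (charge kind dyn x)"
    and "(\<gamma> has_derivative (\<lambda>u. R *v u)) (at (res_currents kind x))"
    and "\<And>e. kind e = Memristor \<Longrightarrow> z_at x $ e = 0"
  shows "((\<lambda>x. g_map kind dyn K B Q M \<gamma> V I x $ i) has_derivative
    (\<lambda>v. g_map kind dyn K B Q (\<lambda>_. M (charge kind dyn x)) (\<lambda>i. R *v i) 0 0 v $ i)) (at x)"
proof (cases "i \<in> K")
  case True
  then show ?thesis unfolding g_map_def vec_lambda_beta matrix_vector_mult_def[of B] if_P[OF True]
    by (intro has_derivative_sum has_derivative_mult_right has_derivative_branch_voltages[OF assms])
next
  case False
  then show ?thesis unfolding g_map_def vec_lambda_beta matrix_vector_mult_def[of Q] if_not_P[OF False]
    by (intro has_derivative_sum has_derivative_mult_right has_derivative_branch_currents)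
qed

lemma has_derivative_stack:
  fixes x :: "real ^ ('d::finite + 'e::finite)"
  assumes "\<And>d. ((\<lambda>x. h x $ d) has_derivative (\<lambda>v. h' v $ d)) (at x)"
    and "\<And>e. ((\<lambda>x. g x $ e) has_derivative (\<lambda>v. g' v $ e)) (at x)"
  shows "((\<lambda>x. stack (h x) (g x) :: real ^ ('d + 'e)) has_derivative (\<lambda>v. stack (h' v) (g' v))) (at x)"
proof (rule has_derivative_vec_componentwise)
  fix i :: "'d + 'e"
  show "((\<lambda>x. stack (h x) (g x) $ i) has_derivative (\<lambda>v. stack (h' v) (g' v) $ i)) (at x)"
    using assms by (cases i) (simp_all add: stack_def)
qed

lemma jacobian_mult:
  fixes f :: "real ^ 'n::finite \<Rightarrow> real ^ 'm::finite"
  assumes "(f has_derivative f') (at x)"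
  shows "jacobian f (at x) *v v = f' v"
  unfolding jacobian_def frechet_derivative_at[OF assms, symmetric]
  by (rule matrix_works) (simp add: linear_matrix_vector_mul_eq has_derivative_linear[OF assms])

section \<open>Kirchhoff matrices with device weights\<close>

text \<open>
  The linear devices force \<open>v = b w\<close> and \<open>i = q w\<close> for one free variable \<open>w\<close> per branch, where \<open>b\<close> is the
  loop weight and \<open>q\<close> the cut weight.  The reactive class \<open>X\<close> has prescribed voltages, like
  the voltage sources, and the reactive class \<open>Y\<close> has prescribed currents, like the current sources.
\<close>

definition loop_weight ::
  "('e \<Rightarrow> device) \<Rightarrow> device \<Rightarrow> device \<Rightarrow> real \<Rightarrow> ('e \<Rightarrow> real) \<Rightarrow> 'e \<Rightarrow> real" where
  "loop_weight kind X Y m r e = (if kind e \<in> {VSource, X} then 0 else if kind e \<in> {CSource, Y} then 1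
     else if kind e = Memristor then m else r e)"

definition cut_weight :: "('e \<Rightarrow> device) \<Rightarrow> device \<Rightarrow> 'e \<Rightarrow> real" where
  "cut_weight kind Y e = (if kind e \<in> {CSource, Y} then 0 else 1)"

lemma tree_weight_MR_product:
  fixes G :: "('v, 'e::finite) pre_digraph"
  assumes "arcs G = UNIV" "{X, Y} = {Capacitor, Inductor}"
  shows "(\<Prod>e\<in>T. cut_weight kind Y e) * (\<Prod>e\<in>-T. loop_weight kind X Y m r e) =
    (if {e \<in> arcs G. kind e \<in> {VSource, X}} \<subseteq> T \<and> {e \<in> arcs G. kind e \<in> {CSource, Y}} \<inter> T = {}
     then MR_product G kind m r T else 0)"
proof -
  let ?P = "{e. kind e \<in> {VSource, X}}" and ?N = "{e. kind e \<in> {CSource, Y}}"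
  have XY: "X = Capacitor \<and> Y = Inductor \<or> X = Inductor \<and> Y = Capacitor"
    using assms(2) by (auto simp: doubleton_eq_iff)
  then have "?P \<inter> ?N = {}" by auto
  from tree_weight[OF this, of T "\<lambda>e. if kind e = Memristor then m else r e"]
  have weight: "(\<Prod>e\<in>T. cut_weight kind Y e) * (\<Prod>e\<in>-T. loop_weight kind X Y m r e) =
    (if ?P \<subseteq> T \<and> ?N \<inter> T = {} then \<Prod>e\<in>-(T \<union> ?N). if kind e = Memristor then m else r e else 0)"
    unfolding cut_weight_def loop_weight_def mem_Collect_eq .
  have "- (T \<union> ?N) = {e \<in> arcs G - T. kind e \<in> {Memristor, Resistor}}" if "?P \<subseteq> T"
  proof -
    have "kind e \<in> {Memristor, Resistor} \<longleftrightarrow> kind e \<notin> {VSource, X} \<and> kind e \<notin> {CSource, Y}" for e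
      using XY by (cases "kind e") auto
    then show ?thesis using that assms(1) by auto
  qed
  then have MR: "(\<Prod>e\<in>-(T \<union> ?N). if kind e = Memristor then m else r e) = MR_product G kind m r T"
    if "?P \<subseteq> T" using that unfolding MR_product_def by (simp only:)
  have "{e \<in> arcs G. kind e \<in> {VSource, X}} = ?P" "{e \<in> arcs G. kind e \<in> {CSource, Y}} = ?N"
    by (simp_all add: assms(1))
  note sets = this
  show ?thesis
  proof (cases "?P \<subseteq> T \<and> ?N \<inter> T = {}")
    case True
    show ?thesis unfolding weight sets if_P[OF True] by (rule MR[OF conjunct1[OF True]])
  next
    case False
    show ?thesis unfolding weight sets if_not_P[OF False] ..
  qed
qed

lemma det_weighted_kirchhoff_matrix:
  fixes G :: "('v, 'e::finite) pre_digraph"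
  assumes "wf_digraph G" "arcs G = UNIV" "Digraph_Component.connected G"
    and "reduced_loop_matrix G K B" and "reduced_cutset_matrix G (- K) Q"
    and "{X, Y} = {Capacitor, Inductor}"
  shows "\<exists>k. k \<noteq> 0 \<and>
    det (\<chi> i e. (if i \<in> K then loop_weight kind X Y m r e else cut_weight kind Y e) * kirchhoff_matrix K B Q $ i $ e)
      = k * (\<Sum>T | is_spanning_tree G T \<and> {e \<in> arcs G. kind e \<in> {VSource, X}} \<subseteq> T
          \<and> {e \<in> arcs G. kind e \<in> {CSource, Y}} \<inter> T = {}. MR_product G kind m r T)"
proof -
  let ?N = "\<chi> i e. (if i \<in> K then loop_weight kind X Y m r e else cut_weight kind Y e) * kirchhoff_matrix K B Q $ i $ e"
  define proper where "proper T \<longleftrightarrow> {e \<in> arcs G. kind e \<in> {VSource, X}} \<subseteq> T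
      \<and> {e \<in> arcs G. kind e \<in> {CSource, Y}} \<inter> T = {}" for T
  from det_scaled_kirchhoff_matrix[OF assms(1-5)]
  obtain k where k: "k \<noteq> 0 \<and>
    (\<forall>b q. det (\<chi> i e. (if i \<in> K then b e else q e) * kirchhoff_matrix K B Q $ i $ e)
       = k * (\<Sum>T | is_spanning_tree G T. (\<Prod>e\<in>T. q e) * (\<Prod>e\<in>-T. b e)))" ..
  from k[THEN conjunct2, THEN spec, THEN spec, of "loop_weight kind X Y m r" "cut_weight kind Y"]
  have "det ?N = k * (\<Sum>T | is_spanning_tree G T. if proper T then MR_product G kind m r T else 0)"
    unfolding tree_weight_MR_product[OF assms(2,6)] proper_def .
  also have "\<dots> = k * (\<Sum>T | is_spanning_tree G T \<and> proper T. MR_product G kind m r T)"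
    by (simp add: sum.If_cases Collect_conj_eq)
  finally show ?thesis using k unfolding proper_def by (intro exI[of _ k] conjI) (rule conjunct1)
qed

lemma g_map_eq_mult:
  assumes "\<And>e. branch_voltages kind dyn M \<gamma> V x $ e = b e * w $ e"
    and "\<And>e. branch_currents kind dyn I x $ e = q e * w $ e"
  shows "g_map kind dyn K B Q M \<gamma> V I x
    = (\<chi> i e. (if i \<in> K then b e else q e) * kirchhoff_matrix K B Q $ i $ e) *v w"
  by (auto simp: vec_eq_iff g_map_def matrix_vector_mult_def assms kirchhoff_matrix_def row_def mult_ac
    intro!: sum.cong)

lemma y_at_stack:
  assumes "enumerates_dynamic dyn kind"
  shows "y_at dyn (stack y z) $ dyn d = y $ d"
  using assms by (simp add: y_at_def stack_def enumerates_dynamic_def bij_betw_def)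

lemma resistor_voltage_uncoupled:
  fixes R :: "real ^ 'e::finite ^ 'e"
  assumes "\<And>e e'. kind e = Resistor \<Longrightarrow> kind e' = Resistor \<Longrightarrow> e \<noteq> e' \<Longrightarrow> R $ e $ e' = 0"
    and "kind e = Resistor"
  shows "(R *v on_class kind Resistor w) $ e = R $ e $ e * w $ e"
proof -
  have "R $ e $ j * on_class kind Resistor w $ j = (if e = j then R $ e $ e * w $ e else 0)" for j
    using assms by (auto simp: on_class_def)
  then show ?thesis by (simp add: matrix_vector_mult_def)
qed

text \<open>
  With the dynamic variables held at zero, capacitors are short circuits and inductors open circuits,
  which leads to the sum over proper trees.
\<close>

lemma algebraic_part_linearised:
  fixes kind :: "'e::finite \<Rightarrow> device" and dyn :: "'d::finite \<Rightarrow> 'e" and R :: "real ^ 'e ^ 'e"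
  assumes "\<And>e e'. kind e = Resistor \<Longrightarrow> kind e' = Resistor \<Longrightarrow> e \<noteq> e' \<Longrightarrow> R $ e $ e' = 0"
  shows "g_map kind dyn K B Q (\<lambda>_. m) (\<lambda>i. R *v i) 0 0 (stack 0 z)
    = (\<chi> i e. (if i \<in> K then loop_weight kind Capacitor Inductor m (\<lambda>e. R $ e $ e) e
        else cut_weight kind Inductor e) * kirchhoff_matrix K B Q $ i $ e) *v z"
proof (rule g_map_eq_mult)
  have y: "y_at dyn (stack 0 z) = 0" by (simp add: y_at_def stack_def vec_eq_iff)
  show "branch_voltages kind dyn (\<lambda>_. m) (\<lambda>i. R *v i) 0 (stack 0 z) $ e
      = loop_weight kind Capacitor Inductor m (\<lambda>e. R $ e $ e) e * z $ e" for e
    using resistor_voltage_uncoupled[of kind R e z] assms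
    by (cases "kind e") (simp_all add: branch_voltages_def loop_weight_def y res_currents_def)
  show "branch_currents kind dyn 0 (stack 0 z) $ e = cut_weight kind Inductor e * z $ e" for e
    by (cases "kind e") (simp_all add: branch_currents_def cut_weight_def y)
qed

text \<open>
  In a steady state the capacitors carry no current and the inductors no voltage, so the capacitor
  voltages and inductor currents become the free variables.  The memristor charge, which does not enter
  the linearised equations, is set to the memristor current, as the Jordan chain requires.
\<close>

definition steady_state :: "('e \<Rightarrow> device) \<Rightarrow> ('d \<Rightarrow> 'e) \<Rightarrow> real ^ 'e \<Rightarrow> real ^ ('d::finite + 'e::finite)" where
  "steady_state kind dyn w = stack (\<chi> d. w $ dyn d) (\<chi> e. if kind e \<in> {Capacitor, Inductor} then 0 else w $ e)"

text \<open>
  Compared with the equations for fixed dynamic variables, capacitors and inductors have exchanged their roles: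
  capacitors are open circuits and inductors short circuits.  This leads to the sum over L-proper trees.
\<close>

lemma steady_state_equations:
  fixes kind :: "'e::finite \<Rightarrow> device" and dyn :: "'d::finite \<Rightarrow> 'e" and R :: "real ^ 'e ^ 'e"
  assumes dyn: "enumerates_dynamic dyn kind"
    and "\<And>e e'. kind e = Resistor \<Longrightarrow> kind e' = Resistor \<Longrightarrow> e \<noteq> e' \<Longrightarrow> R $ e $ e' = 0"
  shows "g_map kind dyn K B Q (\<lambda>_. m) (\<lambda>i. R *v i) 0 0 (steady_state kind dyn w)
    = (\<chi> i e. (if i \<in> K then loop_weight kind Inductor Capacitor m (\<lambda>e. R $ e $ e) e
        else cut_weight kind Capacitor e) * kirchhoff_matrix K B Q $ i $ e) *v w"
proof (rule g_map_eq_mult)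
  let ?v = "steady_state kind dyn w"
  have y: "y_at dyn ?v $ e = w $ e" if dynamic: "kind e \<in> {Memristor, Capacitor, Inductor}" for e
  proof -
    obtain d where "dyn d = e" using enumerates_dynamic_surj[OF dyn dynamic] by blast
    then show ?thesis using y_at_stack[OF dyn] by (auto simp: steady_state_def)
  qed
  have z: "z_at ?v $ e = (if kind e \<in> {Capacitor, Inductor} then 0 else w $ e)" for e
    by (simp add: steady_state_def)
  show "branch_voltages kind dyn (\<lambda>_. m) (\<lambda>i. R *v i) 0 ?v $ e
      = loop_weight kind Inductor Capacitor m (\<lambda>e. R $ e $ e) e * w $ e" for e
    using resistor_voltage_uncoupled[of kind R e "z_at ?v"] assms(2) y[of e]
    by (cases "kind e") (simp_all add: branch_voltages_def loop_weight_def res_currents_def z)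
  show "branch_currents kind dyn 0 ?v $ e = cut_weight kind Capacitor e * w $ e" for e
    using y[of e] by (cases "kind e") (simp_all add: branch_currents_def cut_weight_def z)
qed

lemma steady_state_dynamics:
  assumes dyn: "enumerates_dynamic dyn kind"
    and single: "\<And>e. kind e = Memristor \<longleftrightarrow> e = dyn d0"
  shows "h_map kind dyn (\<lambda>_. C) (\<lambda>_. L) (steady_state kind dyn w) = axis d0 (w $ dyn d0)"
proof -
  let ?z = "z_at (steady_state kind dyn w)"
  have z: "?z $ e = (if kind e \<in> {Capacitor, Inductor} then 0 else w $ e)" for e
    by (simp add: steady_state_def)
  have zero: "on_class kind Capacitor ?z = 0" "on_class kind Inductor ?z = 0"
    by (auto simp: on_class_def vec_eq_iff z)
  have mem: "kind (dyn d) = Memristor \<longleftrightarrow> d = d0" for d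
    using single dyn by (auto simp: enumerates_dynamic_def bij_betw_def inj_on_def)
  have "h_map kind dyn (\<lambda>_. C) (\<lambda>_. L) (steady_state kind dyn w) $ d = axis d0 (w $ dyn d0) $ d" for d
    using mem[of d] by (cases "kind (dyn d)") (auto simp: h_map_def zero z axis_def)
  then show ?thesis by (simp add: vec_eq_iff)
qed

lemma steady_state_nonzero:
  assumes dyn: "enumerates_dynamic dyn kind" and "w \<noteq> 0"
  shows "steady_state kind dyn w \<noteq> 0"
proof
  assume zero: "steady_state kind dyn w = 0"
  have "w $ e = 0" for e
  proof (cases "kind e \<in> {Capacitor, Inductor}")
    case True
    then obtain d where "dyn d = e" using enumerates_dynamic_surj[OF dyn, of e] by auto
    then show ?thesis using arg_cong[OF zero, of "\<lambda>v. v $ Inl d"] by (simp add: steady_state_def stack_def)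
  next
    case False
    then show ?thesis using arg_cong[OF zero, of "\<lambda>v. v $ Inr e"] by (simp add: steady_state_def stack_def)
  qed
  then show False using assms(2) by (simp add: vec_eq_iff)
qed

text \<open>
  As the memristor current vanishes at an equilibrium, every other value of the memristor charge gives
  an equilibrium, too.
\<close>

lemma charge_direction_ker:
  fixes kind :: "'e::finite \<Rightarrow> device" and dyn :: "'d::finite \<Rightarrow> 'e"
  assumes dyn: "enumerates_dynamic dyn kind" and mem: "kind (dyn d0) = Memristor"
  shows "linearised_circuit kind dyn K B Q C L m R (axis (Inl d0) 1) = 0"
proof -
  let ?v = "axis (Inl d0) 1 :: real ^ ('d + 'e)"
  have z: "z_at ?v = 0" by (simp add: z_at_def axis_def vec_eq_iff)
  have y: "y_at dyn ?v $ e = 0" if dynamic: "kind e \<in> {Capacitor, Inductor}" for e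
  proof -
    obtain d where d: "dyn d = e" using enumerates_dynamic_surj[OF dyn, of e] dynamic by auto
    then have "d \<noteq> d0" using dynamic mem by auto
    moreover have "inv dyn e = d" using d dyn by (auto simp: enumerates_dynamic_def bij_betw_def)
    ultimately show ?thesis by (simp add: y_at_def axis_def)
  qed
  have on0: "on_class kind k 0 = 0" for k by (simp add: on_class_def vec_eq_iff)
  have "h_map kind dyn (\<lambda>_. C) (\<lambda>_. L) ?v $ d = 0" for d
    by (cases "kind (dyn d)") (simp_all add: h_map_def z on0)
  moreover have "g_map kind dyn K B Q (\<lambda>_. m) (\<lambda>i. R *v i) 0 0 ?v
      = (\<chi> i e. (if i \<in> K then 0 else 0) * kirchhoff_matrix K B Q $ i $ e) *v 0"
  proof (rule g_map_eq_mult)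
    show "branch_voltages kind dyn (\<lambda>_. m) (\<lambda>i. R *v i) 0 ?v $ e = 0 * 0 $ e" for e
      using y[of e] by (cases "kind e") (simp_all add: branch_voltages_def z res_currents_def on0)
    show "branch_currents kind dyn 0 ?v $ e = 0 * 0 $ e" for e
      using y[of e] by (cases "kind e") (simp_all add: branch_currents_def z)
  qed
  ultimately show ?thesis
    by (simp add: linearised_circuit_def stack_def vec_eq_iff split: sum.split)
qed

theorem proposition1:
  fixes G :: "('v, 'e::finite) pre_digraph"
    and kind :: "'e \<Rightarrow> device"
    and dyn :: "'d::finite \<Rightarrow> 'e"
    and K :: "'e set"
    and B Q :: "real ^ 'e ^ 'e"
    and \<phi> M :: "real \<Rightarrow> real"
    and C L R :: "real ^ 'e \<Rightarrow> real ^ 'e ^ 'e"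
    and \<gamma> :: "real ^ 'e \<Rightarrow> real ^ 'e"
    and V I :: "real ^ 'e"
    and x :: "real ^ ('d + 'e)"
  defines "h \<equiv> h_map kind dyn C L"
    and "g \<equiv> g_map kind dyn K B Q M \<gamma> V I"
    and "MR \<equiv> MR_product G kind (M (charge kind dyn x)) (\<lambda>e. R (res_currents kind x) $ e $ e)"
  assumes "fin_digraph G" and "arcs G = UNIV" and "Digraph_Component.connected G"
    and "\<exists>!e. kind e = Memristor"
    and "enumerates_dynamic dyn kind"
    and "reduced_loop_matrix G K B" and "reduced_cutset_matrix G (- K) Q"
    and "\<And>q. (\<phi> has_real_derivative M q) (at q)" and "M C1_differentiable_on UNIV"
    and "C2_with_derivative \<gamma> R"
    and "isCont C (cap_voltages kind dyn x)" and "isCont L (ind_currents kind dyn x)"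
    and equilibrium: "h x = 0" "g x = 0"
    and "invertible (class_block kind Capacitor (C (cap_voltages kind dyn x)))"
    and "invertible (class_block kind Inductor (L (ind_currents kind dyn x)))"
    and uncoupled_resistances:
      "\<And>e e'. kind e = Resistor \<Longrightarrow> kind e' = Resistor \<Longrightarrow> e \<noteq> e' \<Longrightarrow>
        R (res_currents kind x) $ e $ e' = 0"
    and no_VC_loop: "\<nexists>S. is_loop G S \<and> kind ` S \<subseteq> {VSource, Capacitor}"
    and no_IL_cutset: "\<nexists>S. is_cutset G S \<and> kind ` S \<subseteq> {CSource, Inductor}"
    and no_VL_loop: "\<nexists>S. is_loop G S \<and> kind ` S \<subseteq> {VSource, Inductor}"
    and no_IC_cutset: "\<nexists>S. is_cutset G S \<and> kind ` S \<subseteq> {CSource, Capacitor}"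
    and "(\<Sum>T | proper_tree G kind T. MR T) \<noteq> 0"
    and "(\<Sum>T | L_proper_tree G kind T. MR T) = 0"
  defines "p \<equiv> pencil_poly (jacobian (\<lambda>x. stack (h x) (g x)) (at x))"
  shows "p \<noteq> 0 \<and> order 0 p > 1"
proof -
  define m where "m = M (charge kind dyn x)"
  define R0 where "R0 = R (res_currents kind x)"
  define C0 where "C0 = C (cap_voltages kind dyn x)"
  define L0 where "L0 = L (ind_currents kind dyn x)"
  define J where "J = jacobian (\<lambda>x. stack (h x) (g x)) (at x)"
  have wf: "wf_digraph G" using assms(4) by (simp add: fin_digraph_def)
  have dyn: "enumerates_dynamic dyn kind" by fact
  have uncoupled: "R0 $ e $ e' = 0" if "kind e = Resistor" "kind e' = Resistor" "e \<noteq> e'" for e e'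
    using uncoupled_resistances[OF that] by (simp add: R0_def)

  have h0: "h_map kind dyn C L x = 0" using equilibrium(1) by (simp add: h_def)
  obtain M' where "\<forall>q\<in>UNIV. (M has_vector_derivative M' q) (at q)"
    using \<open>M C1_differentiable_on UNIV\<close> unfolding C1_differentiable_on_def by blast
  then have "isCont M q" for q by (intro has_vector_derivative_continuous) auto
  moreover have "(\<gamma> has_derivative (\<lambda>u. R0 *v u)) (at (res_currents kind x))"
    using \<open>C2_with_derivative \<gamma> R\<close> by (simp add: C2_with_derivative_def R0_def)
  moreover have "z_at x $ e = 0" if "kind e = Memristor" for e
    by (rule equilibrium_memristor_current[OF dyn h0 that])
  ultimately have "((\<lambda>x. g x $ i) has_derivative
      (\<lambda>v. g_map kind dyn K B Q (\<lambda>_. m) (\<lambda>i. R0 *v i) 0 0 v $ i)) (at x)" for i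
    unfolding g_def m_def by (intro has_derivative_g_map)
  moreover have "((\<lambda>x. h x $ d) has_derivative (\<lambda>v. h_map kind dyn (\<lambda>_. C0) (\<lambda>_. L0) v $ d)) (at x)" for d
    unfolding h_def C0_def L0_def
    using equilibrium_capacitor_currents[OF dyn h0 assms(18)] equilibrium_inductor_voltages[OF dyn h0 assms(19)]
    by (rule has_derivative_h_map[OF assms(14,18,15,19)])
  ultimately have "((\<lambda>x. stack (h x) (g x)) has_derivative linearised_circuit kind dyn K B Q C0 L0 m R0) (at x)"
    unfolding linearised_circuit_def[abs_def] by (intro has_derivative_stack)
  then have J: "J *v v = linearised_circuit kind dyn K B Q C0 L0 m R0 v" for v
    unfolding J_def by (rule jacobian_mult)

  \<comment> \<open>Both determinants are instances of the same weighted tree formula.\<close>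
  let ?N = "\<lambda>X Y. \<chi> i e. (if i \<in> K then loop_weight kind X Y m (\<lambda>e. R0 $ e $ e) e else cut_weight kind Y e)
    * kirchhoff_matrix K B Q $ i $ e"
  have MR: "MR = MR_product G kind m (\<lambda>e. R0 $ e $ e)" by (simp add: MR_def m_def R0_def)
  have reduced: "reduced_loop_matrix G K B" "reduced_cutset_matrix G (- K) Q" by fact+
  have "\<exists>k. k \<noteq> 0 \<and> det (?N Capacitor Inductor) = k * (\<Sum>T | proper_tree G kind T. MR T)"
    unfolding proper_tree_def MR by (rule det_weighted_kirchhoff_matrix[OF wf assms(5,6) reduced refl])
  then have det_proper: "det (?N Capacitor Inductor) \<noteq> 0"
    using \<open>(\<Sum>T | proper_tree G kind T. MR T) \<noteq> 0\<close> by (elim exE conjE) simp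
  have "\<exists>k. k \<noteq> 0 \<and> det (?N Inductor Capacitor) = k * (\<Sum>T | L_proper_tree G kind T. MR T)"
    unfolding L_proper_tree_def MR by (rule det_weighted_kirchhoff_matrix[OF wf assms(5,6) reduced insert_commute])
  then have "det (?N Inductor Capacitor) = 0"
    using \<open>(\<Sum>T | L_proper_tree G kind T. MR T) = 0\<close> by (elim exE conjE) simp
  then obtain w where w: "w \<noteq> 0" "?N Inductor Capacitor *v w = 0"
    using det_nonzero_iff_ker by blast

  have alg: "g_map kind dyn K B Q (\<lambda>_. m) (\<lambda>i. R0 *v i) 0 0 (stack 0 z) = ?N Capacitor Inductor *v z" for z
    by (rule algebraic_part_linearised, rule uncoupled)
  have steady: "g_map kind dyn K B Q (\<lambda>_. m) (\<lambda>i. R0 *v i) 0 0 (steady_state kind dyn w)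
      = ?N Inductor Capacitor *v w"
    by (rule steady_state_equations[OF dyn], rule uncoupled)
  have nonzero: "pencil_poly J \<noteq> 0"
  proof (rule pencil_poly_nonzero)
    fix z assume "z_at (J *v stack 0 z) = 0"
    then have "?N Capacitor Inductor *v z = 0"
      unfolding J linearised_circuit_def alg z_at_stack .
    then show "z = 0" using det_proper det_nonzero_iff_ker by blast
  qed
  \<comment> \<open>The kernel vector \<open>w\<close> yields a steady state, which extends the charge direction to a chain of length two.\<close>
  obtain e0 where e0: "\<And>e. kind e = Memristor \<longleftrightarrow> e = e0" using assms(7) by blast
  obtain d0 where d0: "dyn d0 = e0" using enumerates_dynamic_surj[OF dyn, of e0] e0 by auto
  have single: "kind e = Memristor \<longleftrightarrow> e = dyn d0" for e using e0 d0 by simp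
  let ?v = "steady_state kind dyn w"
  have "order 0 (pencil_poly J) > 1"
  proof (rule pencil_poly_double_zero[OF _ _ _ nonzero])
    show "J *v axis (Inl d0) 1 = 0"
      unfolding J by (rule charge_direction_ker[OF dyn]) (simp add: single)
    show "?v \<noteq> 0" by (rule steady_state_nonzero[OF dyn w(1)])
    have "J *v ?v = stack (axis d0 (w $ dyn d0)) 0"
      unfolding J linearised_circuit_def steady_state_dynamics[OF dyn single]
        steady w(2) ..
    also have "\<dots> = axis (Inl d0) (?v $ Inl d0)"
      by (auto simp: steady_state_def stack_def axis_def vec_eq_iff split: sum.split)
    finally show "J *v ?v = axis (Inl d0) (?v $ Inl d0)" .
  qed
  with nonzero show ?thesis by (simp add: p_def J_def)
qed

end
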